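(* Let $n\ge 1$, let $a\in\mathbb{R}^n$, let $t\in\mathbb{R}$ with $t\neq 0$, and let $\rho\in L^1(\mathbb{R}^n)$ satisfy $\rho\ge 0$, $\sqrt{\rho}\in L^1(\mathbb{R}^n)$ and $\int_{\mathbb{R}^n}\rho(x)\,dx=1$. For $\varepsilon\in(0,1]$ let $\mu^t_\varepsilon$ be the Borel probability measure on $\mathbb{R}^n$ with Lebesgue density $|u_\varepsilon(\cdot,t)|^2$, where $u_\varepsilon(\cdot,t)=e^{it\Delta}\sqrt{\delta_a*\rho_\varepsilon}$, i.e. $u_\varepsilon$ is the $L^2$-solution of $\partial_t u_\varepsilon=i\Delta u_\varepsilon$ with initial value $u_\varepsilon|_{t=0}=\sqrt{\rho_\varepsilon(\cdot-a)}$. Then, as $\varepsilon\to0$, the net $(\mu^t_\varepsilon)_{\varepsilon\in(0,1]}$, regarded as a net of measures on the Bohr compactification $b\mathbb{R}^n$ of $\mathbb{R}^n$, converges to the normalized Haar measure on $b\mathbb{R}^n$ with respect to the weak* topology in $M(b\mathbb{R}^n)\cong C(b\mathbb{R}^n)'$.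
   Context: Notation: $\rho_\varepsilon(x)=\varepsilon^{-n}\rho(x/\varepsilon)$ for $\varepsilon\in(0,1]$; $\delta_a$ is the Dirac measure at $a$, so $(\delta_a*\rho_\varepsilon)(x)=\rho_\varepsilon(x-a)$. $(e^{it\Delta})_{t\in\mathbb{R}}$ is the strongly continuous unitary group on $L^2(\mathbb{R}^n)$ generated by the Laplacian with domain $H^2(\mathbb{R}^n)$; with the Fourier transform $\mathcal{F}g(\xi)=\int_{\mathbb{R}^n} e^{-i\langle x,\xi\rangle}g(x)\,dx$ (extended to $L^2$) it is given by $\mathcal{F}(e^{it\Delta}g)(\xi)=e^{-it|\xi|^2}\mathcal{F}g(\xi)$. Since $\sqrt{\rho_\varepsilon(\cdot-a)}$ has $L^2$-norm $1$, $\mu^t_\varepsilon$ is a probability measure. The Bohr compactification $b\mathbb{R}^n$ is the group of all (not necessarily continuous) group homomorphisms from $\mathbb{R}^n$ to the circle group $S^1$, with the topology of pointwise convergence; it is a compact Hausdorff Abelian topological group. $\mathbb{R}^n$ is embedded continuously and injectively as a dense subgroup by $\iota\colon\mathbb{R}^n\to b\mathbb{R}^n$, $\iota(x)=(\xi\mapsto e^{i\langle x,\xi\rangle})$. $M(b\mathbb{R}^n)$ is the space of finite regular complex Borel measures on $b\mathbb{R}^n$, identified with the dual of $C(b\mathbb{R}^n)$; $\mu^t_\varepsilon$ is regarded as an element of it via the functional $h\mapsto\int_{\mathbb{R}^n}h(\iota(x))\,d\mu^t_\varepsilon(x)$ for $h\in C(b\mathbb{R}^n)$. Normalized Haar measure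 is the unique translation-invariant regular Borel probability measure on $b\mathbb{R}^n$. *)

theory Defs
  imports "HOL-Analysis.Analysis"
begin

section \<open>The Bohr compactification of Euclidean space\<close>

text \<open>
  All group homomorphisms (continuous or not) from \<open>real ^ 'n\<close> to the circle, as a subset of the
  function type. The library topology of a function type is the product topology, so
  \<^term>\<open>top_of_set bohr\<close> is the topology of pointwise convergence; compactness and continuity
  below refer to it. The group operation is pointwise multiplication.
\<close>

definition bohr :: "(real ^ 'n \<Rightarrow> complex) set" where
  "bohr = {\<phi>. (\<forall>x. cmod (\<phi> x) = 1) \<and> (\<forall>x y. \<phi> (x + y) = \<phi> x * \<phi> y)}"

definition bohr_embed :: "real ^ 'n \<Rightarrow> (real ^ 'n \<Rightarrow> complex)" where
  "bohr_embed x = (\<lambda>\<xi>. exp (\<i> * of_real (x \<bullet> \<xi>)))"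

text \<open>
  The Borel \<open>\<sigma>\<close>-algebra of the subspace \<^const>\<open>bohr\<close> is the trace of \<^const>\<open>borel\<close>, which on the
  function type is generated by all open sets of the (uncountable) product topology and
  is hence strictly larger than the product \<open>\<sigma>\<close>-algebra. Regularity determines the
  measure among the translation-invariant probability measures on it.
\<close>

definition bohr_haar_measure :: "(real ^ 'n \<Rightarrow> complex) measure \<Rightarrow> bool" where
  "bohr_haar_measure \<nu> \<longleftrightarrow>
     sets \<nu> = sets (restrict_space borel bohr) \<and>
     emeasure \<nu> (space \<nu>) = 1 \<and>
     (\<forall>A\<in>sets \<nu>. emeasure \<nu> A =
        (INF U\<in>{U. openin (top_of_set bohr) U \<and> A \<subseteq> U}. emeasure \<nu> U)) \<and>
     (\<forall>A\<in>sets \<nu>. emeasure \<nu> A = (SUP K\<in>{K. compact K \<and> K \<subseteq> A}. emeasure \<nu> K)) \<and>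
     (\<forall>\<psi>\<in>bohr. \<forall>A\<in>sets \<nu>. emeasure \<nu> ((\<lambda>\<phi> x. \<psi> x * \<phi> x) ` A) = emeasure \<nu> A)"


section \<open>The dual of the continuous functions, with the weak* topology\<close>

text \<open>
  A continuous function on \<^const>\<open>bohr\<close> is represented by any extension of it to the whole function
  type. The values off \<^const>\<open>bohr\<close> are irrelevant: the bound in \<open>bohr_dual\<close> forces a
  functional to agree on functions that coincide on \<^const>\<open>bohr\<close>.
\<close>

definition bohr_continuous :: "((real ^ 'n \<Rightarrow> complex) \<Rightarrow> complex) set" where
  "bohr_continuous = {h. continuous_on bohr h}"

definition bohr_dual :: "(((real ^ 'n \<Rightarrow> complex) \<Rightarrow> complex) \<Rightarrow> complex) set" where
  "bohr_dual = {L \<in> extensional bohr_continuous.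
     (\<forall>f\<in>bohr_continuous. \<forall>g\<in>bohr_continuous. L (\<lambda>\<phi>. f \<phi> + g \<phi>) = L f + L g) \<and>
     (\<forall>c. \<forall>f\<in>bohr_continuous. L (\<lambda>\<phi>. c * f \<phi>) = c * L f) \<and>
     (\<exists>B. \<forall>f\<in>bohr_continuous. cmod (L f) \<le> B * (SUP \<phi>\<in>bohr. cmod (f \<phi>)))}"

definition bohr_weak_star ::
    "(((real ^ 'n \<Rightarrow> complex) \<Rightarrow> complex) \<Rightarrow> complex) topology" where
  "bohr_weak_star =
     subtopology (product_topology (\<lambda>_. euclidean) bohr_continuous) bohr_dual"

text \<open>
  Complex measures on \<^const>\<open>bohr\<close> are handled through the dual. The first map below is the
  identification for a positive measure on \<^const>\<open>bohr\<close>, the second one regards a measure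
  on \<open>real ^ 'n\<close> as an element of the dual.
\<close>

definition bohr_functional ::
    "(real ^ 'n \<Rightarrow> complex) measure \<Rightarrow> ((real ^ 'n \<Rightarrow> complex) \<Rightarrow> complex) \<Rightarrow> complex" where
  "bohr_functional \<nu> = (\<lambda>h\<in>bohr_continuous. LINT \<phi>|\<nu>. h \<phi>)"

definition euclidean_functional ::
    "(real ^ 'n) measure \<Rightarrow> ((real ^ 'n \<Rightarrow> complex) \<Rightarrow> complex) \<Rightarrow> complex" where
  "euclidean_functional \<mu> = (\<lambda>h\<in>bohr_continuous. LINT x|\<mu>. h (bohr_embed x))"


section \<open>The free Schroedinger group\<close>

definition square_integrable :: "(real ^ 'n \<Rightarrow> complex) \<Rightarrow> bool" where
  "square_integrable g \<longleftrightarrow>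
     g \<in> borel_measurable lborel \<and> integrable lborel (\<lambda>x. (cmod (g x))\<^sup>2)"

definition fourier :: "(real ^ 'n \<Rightarrow> complex) \<Rightarrow> real ^ 'n \<Rightarrow> complex" where
  "fourier g \<xi> = (LINT x|lborel. exp (- \<i> * of_real (x \<bullet> \<xi>)) * g x)"

text \<open>
  \<open>L2_fourier g G\<close>: \<open>G\<close> represents the Fourier transform of the \<open>L\<^sup>2\<close> class of \<open>g\<close>, i.e. the value
  at \<open>g\<close> of the \<open>L\<^sup>2\<close>-continuous extension of \<open>fourier\<close> from the dense subspace
  of functions that are both integrable and square integrable. As \<open>L\<^sup>2\<close> consists of classes modulo
  null sets, this and the next notion are relations between representatives;
  the second argument is determined almost everywhere by the first.
\<close>

definition L2_fourier :: "(real ^ 'n \<Rightarrow> complex) \<Rightarrow> (real ^ 'n \<Rightarrow> complex) \<Rightarrow> bool" where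
  "L2_fourier g G \<longleftrightarrow> square_integrable g \<and> square_integrable G \<and>
     (\<exists>s :: nat \<Rightarrow> real ^ 'n \<Rightarrow> complex.
        (\<forall>k. integrable lborel (s k) \<and> square_integrable (s k)) \<and>
        (\<lambda>k. \<integral>\<^sup>+ x. ennreal ((cmod (s k x - g x))\<^sup>2) \<partial>lborel) \<longlonglongrightarrow> 0 \<and>
        (\<lambda>k. \<integral>\<^sup>+ \<xi>. ennreal ((cmod (fourier (s k) \<xi> - G \<xi>))\<^sup>2) \<partial>lborel) \<longlonglongrightarrow> 0)"

text \<open>
  \<open>schroedinger t g u\<close>: \<open>u\<close> represents the image of \<open>g\<close> under the unitary group generated by the
  Laplacian at time \<open>t\<close>, which is the Fourier multiplier with symbol \<open>exp (- \<i> t |\<xi>|\<^sup>2)\<close>.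
\<close>

definition schroedinger ::
    "real \<Rightarrow> (real ^ 'n \<Rightarrow> complex) \<Rightarrow> (real ^ 'n \<Rightarrow> complex) \<Rightarrow> bool" where
  "schroedinger t g u \<longleftrightarrow>
     (\<exists>G. L2_fourier g G \<and> L2_fourier u (\<lambda>\<xi>. exp (- \<i> * of_real (t * (norm \<xi>)\<^sup>2)) * G \<xi>))"

definition rescale :: "real \<Rightarrow> (real ^ 'n \<Rightarrow> real) \<Rightarrow> real ^ 'n \<Rightarrow> real" where
  "rescale \<epsilon> \<rho> x = \<rho> (x /\<^sub>R \<epsilon>) / \<epsilon> ^ CARD('n)"

definition square_density_measure :: "(real ^ 'n \<Rightarrow> complex) \<Rightarrow> (real ^ 'n) measure" where
  "square_density_measure u = density lborel (\<lambda>x. ennreal ((cmod (u x))\<^sup>2))"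

end

theory Submission
  imports Defs "HOL-Probability.Characteristic_Functions"
begin

text \<open>
  By Stone--Weierstrass the trigonometric polynomials are dense in the continuous functions on the
  Bohr compactification, so it suffices to test convergence on characters. There the Haar integral
  vanishes unless the frequency \<open>\<xi>\<close> is \<open>0\<close>. With \<open>g\<close> the initial value, the
  Fourier multiplier and Plancherel's theorem give
  \<open>\<integral> exp (\<i> x \<bullet> \<xi>) |u x|\<^sup>2 dx = exp (- \<i> t |\<xi>|\<^sup>2) \<integral> exp (\<i> x \<bullet> \<xi>) g x cnj (g (x - 2 t \<xi>)) dx\<close>.
  After rescaling, the right-hand side is bounded by the overlap of \<open>sqrt \<rho>\<close> with its translate by
  \<open>2 t \<xi> / \<epsilon>\<close>, which tends to \<open>0\<close> as \<open>\<epsilon> \<rightarrow> 0\<close>.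

  Plancherel's theorem is proved by Gaussian regularisation: \<open>\<integral> |fourier f \<xi>|\<^sup>2 gauss (\<sigma> \<xi>) d\<xi>\<close> is
  a Gaussian average of the autocorrelation of \<open>f\<close>, which is continuous at \<open>0\<close>.
\<close>

text \<open>Testing on characters suffices because all measures involved have mass 1, so replacing a
  test function by a trigonometric polynomial costs the same error for every
  \<open>\<epsilon>\<close>. The displacement \<open>2 t \<xi>\<close> comes from expanding
  \<open>|\<eta> - \<xi>|^2\<close>: the quadratic part \<open>|\<eta>|^2\<close> cancels against
  the conjugate factor, and a constant phase and a phase linear in \<open>\<eta>\<close> remain, the
  latter being the Fourier image of a translation. Dispersion thus turns into a translation whose
  length, in units of \<open>\<epsilon>\<close>, diverges. The obstacle is that the evolution is
  given only as a relation between representatives of \<open>L^2\<close> classes. Rules for the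
  Fourier transform are therefore shown for the integral \<open>fourier\<close> and carried along
  the approximating sequences in \<open>L2_fourier\<close>. The Gaussian weight is what permits
  Fubini, since \<open>|fourier f|^2\<close> is at first only known to be bounded. Estimates of
  Cauchy-Schwarz type are made by Young's inequality with a free weight that is chosen last.\<close>

subsection \<open>Separation in function spaces\<close>

lemma open_coordinate_preimage: "open W \<Longrightarrow> open {h. h x \<in> W}"
  using product_topology_basis'[of "{x}" "\<lambda>_. W" "\<lambda>y. y"] by simp

text \<open>The library only has \<^class>\<open>t0_space\<close> for countable index types, which would block a
  direct \<^class>\<open>t2_space\<close> instance. Stone--Weierstrass needs \<^class>\<open>t2_space\<close>.\<close>

instance "fun" :: (type, t0_space) t0_space
proof
  fix f g :: "'a \<Rightarrow> 'b" assume "f \<noteq> g"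
  then obtain x where "f x \<noteq> g x" by (auto simp: fun_eq_iff)
  from t0_space_class.t0_space[OF this] obtain U where "open U" "\<not> (f x \<in> U \<longleftrightarrow> g x \<in> U)"
    by blast
  then show "\<exists>U. open U \<and> \<not> (f \<in> U \<longleftrightarrow> g \<in> U)"
    by (intro exI[of _ "{h. h x \<in> U}"]) (auto intro: open_coordinate_preimage)
qed

instance "fun" :: (type, t1_space) t1_space
proof
  fix f g :: "'a \<Rightarrow> 'b" assume "f \<noteq> g"
  then obtain x where "f x \<noteq> g x" by (auto simp: fun_eq_iff)
  from t1_space_class.t1_space[OF this] obtain U where "open U" "f x \<in> U" "g x \<notin> U"
    by blast
  then show "\<exists>U. open U \<and> f \<in> U \<and> g \<notin> U"
    by (intro exI[of _ "{h. h x \<in> U}"]) (auto intro: open_coordinate_preimage)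
qed

instance "fun" :: (type, t2_space) t2_space
proof
  fix f g :: "'a \<Rightarrow> 'b" assume "f \<noteq> g"
  then obtain x where "f x \<noteq> g x" by (auto simp: fun_eq_iff)
  from hausdorff[OF this] obtain U V
    where "open U" "open V" "f x \<in> U" "g x \<in> V" "U \<inter> V = {}"
    by blast
  then show "\<exists>U V. open U \<and> open V \<and> f \<in> U \<and> g \<in> V \<and> U \<inter> V = {}"
    by (intro exI[of _ "{h. h x \<in> U}"] exI[of _ "{h. h x \<in> V}"])
      (auto intro: open_coordinate_preimage)
qed

subsection \<open>The Bohr compactification and its Haar measure\<close>

lemma (in prob_space) norm_integral_le:
  fixes f :: "'a \<Rightarrow> 'b :: {banach, second_countable_topology}"
  assumes "integrable M f" "\<And>x. x \<in> space M \<Longrightarrow> norm (f x) \<le> c"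
  shows "norm (LINT x|M. f x) \<le> c"
proof -
  have "norm (LINT x|M. f x) \<le> (LINT x|M. norm (f x))"
    by (rule integral_norm_bound)
  also have "\<dots> \<le> (LINT x|M. c)"
    using assms by (intro integral_mono) auto
  finally show ?thesis by (simp add: prob_space)
qed

lemma bohrD:
  assumes "\<phi> \<in> bohr"
  shows bohr_norm: "cmod (\<phi> x) = 1" and bohr_add: "\<phi> (x + y) = \<phi> x * \<phi> y"
  using assms by (auto simp: bohr_def)

lemma bohr_zero: assumes "\<phi> \<in> bohr" shows "\<phi> 0 = 1"
proof -
  have "\<phi> 0 = \<phi> 0 * \<phi> 0" using bohr_add[OF assms, of 0 0] by simp
  moreover have "\<phi> 0 \<noteq> 0" using bohr_norm[OF assms, of 0] by auto
  ultimately show ?thesis by simp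
qed

text \<open>The value at \<open>- x\<close> is the inverse of a unimodular number, hence its
  conjugate. This makes trigonometric polynomials closed under conjugation on \<open>bohr\<close>,
  as Stone-Weierstrass requires in the complex case.\<close>

lemma bohr_uminus: assumes "\<phi> \<in> bohr" shows "\<phi> (- x) = cnj (\<phi> x)"
proof -
  have 1: "\<phi> x * \<phi> (- x) = 1"
    using bohr_add[OF assms, of x "- x"] bohr_zero[OF assms] by simp
  moreover have "\<phi> x * cnj (\<phi> x) = 1"
    using bohr_norm[OF assms, of x] by (simp flip: complex_norm_square)
  moreover have "\<phi> x \<noteq> 0" using 1 by auto
  ultimately show ?thesis by (metis mult_cancel_left)
qed

lemma bohr_mult: "\<phi> \<in> bohr \<Longrightarrow> \<psi> \<in> bohr \<Longrightarrow> (\<lambda>x. \<phi> x * \<psi> x) \<in> bohr"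
  by (auto simp: bohr_def norm_mult)

lemma bohr_cnj: "\<phi> \<in> bohr \<Longrightarrow> (\<lambda>x. cnj (\<phi> x)) \<in> bohr"
  by (auto simp: bohr_def)

lemma bohr_embed_in_bohr: "bohr_embed x \<in> bohr"
  by (auto simp: bohr_def bohr_embed_def norm_exp_eq_Re inner_add_right distrib_left exp_add)

lemma continuous_on_coordinate: "continuous_on S (\<lambda>\<phi>. \<phi> x)"
  by (rule continuous_on_subset[OF continuous_on_product_coordinates subset_UNIV])

lemma continuous_on_bohr_embed: "continuous_on S bohr_embed"
  unfolding bohr_embed_def
  by (rule continuous_on_coordinatewise_then_product) (intro continuous_intros)

text \<open>Tychonoff gives compactness of the product of circles; each homomorphism equation
  compares two continuous functions of finitely many coordinates and so cuts out a closed
  set.\<close>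

lemma compact_bohr: "compact (bohr :: (real ^ 'n \<Rightarrow> complex) set)"
proof -
  let ?T = "PiE UNIV (\<lambda>_::real ^ 'n. sphere (0::complex) 1)"
  have "compactin (product_topology (\<lambda>_::real ^ 'n. euclidean) UNIV) ?T"
    by (subst compactin_PiE) auto
  then have T: "compact ?T"
    by (simp add: euclidean_product_topology)
  have *: "closed {\<phi> :: real ^ 'n \<Rightarrow> complex. \<phi> (x + y) = \<phi> x * \<phi> y}" for x y
    by (intro closed_Collect_eq continuous_on_mult continuous_on_coordinate)
  have "bohr = ?T \<inter> (\<Inter>x. \<Inter>y. {\<phi> :: real ^ 'n \<Rightarrow> complex. \<phi> (x + y) = \<phi> x * \<phi> y})"
    by (auto simp: bohr_def PiE_iff)
  then show ?thesis
    using T * by (metis (no_types, lifting) closed_INT compact_Int_closed)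
qed

lemma bohr_continuous_bdd_above:
  "h \<in> bohr_continuous \<Longrightarrow> bdd_above ((\<lambda>\<phi>. cmod (h \<phi>)) ` bohr)"
  unfolding bohr_continuous_def
  by (intro bounded_imp_bdd_above compact_imp_bounded compact_continuous_image compact_bohr)
    (auto intro: continuous_on_norm)

lemma cmod_le_SUP_bohr:
  "h \<in> bohr_continuous \<Longrightarrow> \<phi> \<in> bohr \<Longrightarrow> cmod (h \<phi>) \<le> (SUP \<phi>\<in>bohr. cmod (h \<phi>))"
  by (rule cSUP_upper[OF _ bohr_continuous_bdd_above])

section \<open>Density of trigonometric polynomials\<close>

text \<open>The clauses are linear only, so that convergence of integrals can be shown by induction.
  Constants (frequency 0) and products (sums of frequencies) are obtained on \<open>bohr\<close>,
  where the arguments are homomorphisms.\<close>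

inductive trig_poly :: "((real ^ 'n \<Rightarrow> complex) \<Rightarrow> complex) \<Rightarrow> bool" where
  char: "trig_poly (\<lambda>\<phi>. \<phi> \<xi>)"
| add: "trig_poly p \<Longrightarrow> trig_poly q \<Longrightarrow> trig_poly (\<lambda>\<phi>. p \<phi> + q \<phi>)"
| scale: "trig_poly p \<Longrightarrow> trig_poly (\<lambda>\<phi>. c * p \<phi>)"

lemma trig_poly_continuous: "trig_poly p \<Longrightarrow> continuous_on S p"
  by (induction rule: trig_poly.induct)
    (simp_all add: continuous_on_coordinate continuous_on_add continuous_on_mult_left)

lemma trig_poly_mult_char:
  "trig_poly p \<Longrightarrow> \<exists>r. trig_poly r \<and> (\<forall>\<phi>\<in>bohr. r \<phi> = \<phi> \<xi> * p \<phi>)"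
proof (induction rule: trig_poly.induct)
  case (char \<eta>)
  show ?case by (intro exI[of _ "\<lambda>\<phi>. \<phi> (\<xi> + \<eta>)"]) (auto simp: bohr_def intro: trig_poly.char)
next
  case (add p q)
  then obtain r s where "trig_poly r" "trig_poly s" "\<forall>\<phi>\<in>bohr. r \<phi> = \<phi> \<xi> * p \<phi>" "\<forall>\<phi>\<in>bohr. s \<phi> = \<phi> \<xi> * q \<phi>"
    by blast
  then show ?case
    by (intro exI[of _ "\<lambda>\<phi>. r \<phi> + s \<phi>"]) (auto intro: trig_poly.add simp: algebra_simps)
next
  case (scale p c)
  then obtain r where "trig_poly r" "\<forall>\<phi>\<in>bohr. r \<phi> = \<phi> \<xi> * p \<phi>"
    by blast
  then show ?case
    by (intro exI[of _ "\<lambda>\<phi>. c * r \<phi>"]) (auto intro: trig_poly.scale)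
qed

lemma trig_poly_mult:
  assumes "trig_poly p" "trig_poly q"
  shows "\<exists>r. trig_poly r \<and> (\<forall>\<phi>\<in>bohr. r \<phi> = p \<phi> * q \<phi>)"
  using assms(1)
proof (induction rule: trig_poly.induct)
  case (char \<xi>)
  show ?case using trig_poly_mult_char[OF assms(2)] .
next
  case (add p p')
  then obtain r s where "trig_poly r" "trig_poly s" "\<forall>\<phi>\<in>bohr. r \<phi> = p \<phi> * q \<phi>" "\<forall>\<phi>\<in>bohr. s \<phi> = p' \<phi> * q \<phi>"
    by blast
  then show ?case
    by (intro exI[of _ "\<lambda>\<phi>. r \<phi> + s \<phi>"]) (auto intro: trig_poly.add simp: algebra_simps)
next
  case (scale p c)
  then obtain r where "trig_poly r" "\<forall>\<phi>\<in>bohr. r \<phi> = p \<phi> * q \<phi>"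
    by blast
  then show ?case
    by (intro exI[of _ "\<lambda>\<phi>. c * r \<phi>"]) (auto intro: trig_poly.scale)
qed

text \<open>The Stone-Weierstrass theorem is applied to a real algebra: the real functions that some
  complex trigonometric polynomial represents on \<open>bohr\<close>.\<close>

lemma trig_poly_approx_real:
  fixes h :: "(real ^ 'n \<Rightarrow> complex) \<Rightarrow> real"
  assumes "continuous_on bohr h" "e > 0"
  shows "\<exists>p. trig_poly p \<and> (\<forall>\<phi>\<in>bohr. cmod (of_real (h \<phi>) - p \<phi>) < e)"
proof -
  define R :: "((real ^ 'n \<Rightarrow> complex) \<Rightarrow> real) set"
    where "R = {f. \<exists>p. trig_poly p \<and> (\<forall>\<phi>\<in>bohr. p \<phi> = of_real (f \<phi>))}"
  interpret function_ring_on R "bohr :: (real ^ 'n \<Rightarrow> complex) set"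
  proof
    show "compact (bohr :: (real ^ 'n \<Rightarrow> complex) set)" by (rule compact_bohr)
  next
    fix f assume "f \<in> R"
    then obtain p where p: "trig_poly p" "\<forall>\<phi>\<in>bohr. p \<phi> = of_real (f \<phi>)" by (auto simp: R_def)
    have "continuous_on bohr (\<lambda>\<phi>. Re (p \<phi>))"
      by (intro continuous_on_Re trig_poly_continuous p)
    then show "continuous_on bohr f"
      by (rule continuous_on_eq) (simp add: p)
  next
    fix f g assume "f \<in> R" "g \<in> R"
    then obtain p q where pq: "trig_poly p" "\<forall>\<phi>\<in>bohr. p \<phi> = of_real (f \<phi>)"
      "trig_poly q" "\<forall>\<phi>\<in>bohr. q \<phi> = of_real (g \<phi>)" by (auto simp: R_def)
    then show "(\<lambda>x. f x + g x) \<in> R"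
      unfolding R_def by (auto intro!: exI[of _ "\<lambda>\<phi>. p \<phi> + q \<phi>"] trig_poly.add)
    from trig_poly_mult[OF pq(1,3)] pq(2,4) show "(\<lambda>x. f x * g x) \<in> R"
      by (auto simp: R_def)
  next
    fix c
    have "trig_poly (\<lambda>\<phi>::real ^ 'n \<Rightarrow> complex. of_real c * \<phi> 0)"
      by (rule trig_poly.scale[OF trig_poly.char])
    moreover have "of_real c * \<phi> 0 = of_real c" if "\<phi> \<in> bohr" for \<phi> :: "real ^ 'n \<Rightarrow> complex"
      by (simp add: bohr_zero[OF that])
    ultimately show "(\<lambda>_. c) \<in> R"
      unfolding R_def by blast
  next
    fix \<phi> \<psi> :: "real ^ 'n \<Rightarrow> complex" assume b: "\<phi> \<in> bohr" "\<psi> \<in> bohr" "\<phi> \<noteq> \<psi>"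
    then obtain \<xi> where \<xi>: "\<phi> \<xi> \<noteq> \<psi> \<xi>" by auto
    \<comment> \<open>Euler's formulas, with the conjugate of \<open>\<phi> \<xi>\<close> written as
      \<open>\<phi> (- \<xi>)\<close>.\<close>
    have *: "1 / 2 * (\<phi> \<xi> + \<phi> (- \<xi>)) = of_real (Re (\<phi> \<xi>))"
      "- \<i> / 2 * \<phi> \<xi> + \<i> / 2 * \<phi> (- \<xi>) = of_real (Im (\<phi> \<xi>))" if "\<phi> \<in> bohr" for \<phi>
      unfolding bohr_uminus[OF that] by (simp_all add: complex_eq_iff)
    have "trig_poly (\<lambda>\<phi>. 1 / 2 * (\<phi> \<xi> + \<phi> (- \<xi>)))"
      by (rule trig_poly.scale[OF trig_poly.add[OF trig_poly.char trig_poly.char]])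
    with *(1) have Re: "(\<lambda>\<phi>. Re (\<phi> \<xi>)) \<in> R"
      unfolding R_def by blast
    have "trig_poly (\<lambda>\<phi>. - \<i> / 2 * \<phi> \<xi> + \<i> / 2 * \<phi> (- \<xi>))"
      by (rule trig_poly.add[OF trig_poly.scale[OF trig_poly.char] trig_poly.scale[OF trig_poly.char]])
    with *(2) have Im: "(\<lambda>\<phi>. Im (\<phi> \<xi>)) \<in> R"
      unfolding R_def by blast
    \<comment> \<open>Distinct characters differ at some frequency, and there the real or the
      imaginary part tells them apart.\<close>
    show "\<exists>f\<in>R. f \<phi> \<noteq> f \<psi>"
    proof (cases "Re (\<phi> \<xi>) = Re (\<psi> \<xi>)")
      case True
      with \<xi> have "Im (\<phi> \<xi>) \<noteq> Im (\<psi> \<xi>)" by (simp add: complex_eq_iff)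
      then show ?thesis by (rule bexI[OF _ Im])
    next
      case False
      then show ?thesis by (rule bexI[OF _ Re])
    qed
  qed
  obtain g where g: "g \<in> R" "\<forall>\<phi>\<in>bohr. \<bar>h \<phi> - g \<phi>\<bar> < e"
    using Stone_Weierstrass_basic[OF assms] by auto
  show ?thesis
  proof -
    obtain p where p: "trig_poly p" "\<forall>\<phi>\<in>bohr. p \<phi> = of_real (g \<phi>)"
      using \<open>g \<in> R\<close> by (auto simp: R_def)
    have "cmod (of_real (h \<phi>) - p \<phi>) < e" if "\<phi> \<in> bohr" for \<phi>
    proof -
      have "of_real (h \<phi>) - p \<phi> = of_real (h \<phi> - g \<phi>)" using p(2) that by simp
      then have "cmod (of_real (h \<phi>) - p \<phi>) = \<bar>h \<phi> - g \<phi>\<bar>" by (simp only: norm_of_real)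
      with g that show ?thesis by simp
    qed
    with p(1) show ?thesis by blast
  qed
qed

lemma trig_poly_approx:
  fixes h :: "(real ^ 'n \<Rightarrow> complex) \<Rightarrow> complex"
  assumes "h \<in> bohr_continuous" "e > 0"
  obtains p where "trig_poly p" "\<And>\<phi>. \<phi> \<in> bohr \<Longrightarrow> cmod (h \<phi> - p \<phi>) \<le> e"
proof -
  have h: "continuous_on bohr h" using assms by (simp add: bohr_continuous_def)
  obtain p where p: "trig_poly p" "\<forall>\<phi>\<in>bohr. cmod (of_real (Re (h \<phi>)) - p \<phi>) < e / 2"
    using trig_poly_approx_real[of "\<lambda>\<phi>. Re (h \<phi>)" "e / 2"] assms(2) h
    by (auto intro: continuous_on_Re continuous_on_Im)
  obtain q where q: "trig_poly q" "\<forall>\<phi>\<in>bohr. cmod (of_real (Im (h \<phi>)) - q \<phi>) < e / 2"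
    using trig_poly_approx_real[of "\<lambda>\<phi>. Im (h \<phi>)" "e / 2"] assms(2) h
    by (auto intro: continuous_on_Re continuous_on_Im)
  show ?thesis
  proof
    show "trig_poly (\<lambda>\<phi>. p \<phi> + \<i> * q \<phi>)"
      by (intro trig_poly.add trig_poly.scale p q)
    fix \<phi> :: "real ^ 'n \<Rightarrow> complex" assume "\<phi> \<in> bohr"
    have "h \<phi> - (p \<phi> + \<i> * q \<phi>) =
        (of_real (Re (h \<phi>)) - p \<phi>) + \<i> * (of_real (Im (h \<phi>)) - q \<phi>)"
      by (subst complex_eq[of "h \<phi>"]) (simp add: algebra_simps)
    also have "cmod \<dots> \<le> cmod (of_real (Re (h \<phi>)) - p \<phi>) + cmod (of_real (Im (h \<phi>)) - q \<phi>)"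
      by (rule order_trans[OF norm_triangle_ineq]) (simp add: norm_mult)
    finally show "cmod (h \<phi> - (p \<phi> + \<i> * q \<phi>)) \<le> e"
      using p(2) q(2) \<open>\<phi> \<in> bohr\<close> by force
  qed
qed

section \<open>Measures as functionals on the continuous functions\<close>

text \<open>\<open>J\<close> is the identity for measures on \<^const>\<open>bohr\<close> and
  \<^const>\<open>bohr_embed\<close> for measures on Euclidean space.\<close>

lemma bohr_integrable:
  assumes "finite_measure M" "J \<in> space M \<rightarrow> bohr" "h \<in> bohr_continuous"
    "(\<lambda>x. h (J x)) \<in> borel_measurable M"
  shows "integrable M (\<lambda>x. h (J x))"
proof -
  interpret finite_measure M by fact
  show ?thesis
    using assms by (intro integrable_const_bound[where B = "SUP \<phi>\<in>bohr. cmod (h \<phi>)"])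
      (auto intro!: AE_I2 cmod_le_SUP_bohr)
qed

text \<open>The bound demanded by \<open>bohr_dual\<close> holds with the total mass of
  \<open>M\<close> as constant. The map \<open>J\<close> lets one proof serve both identifications
  of measures with functionals.\<close>

lemma integral_in_bohr_dual:
  fixes J :: "'a \<Rightarrow> real ^ 'n \<Rightarrow> complex"
  assumes "finite_measure M" "J \<in> space M \<rightarrow> bohr"
    and meas: "\<And>h. h \<in> bohr_continuous \<Longrightarrow> (\<lambda>x. h (J x)) \<in> borel_measurable M"
  shows "(\<lambda>h\<in>bohr_continuous. LINT x|M. h (J x)) \<in> bohr_dual"
proof -
  interpret finite_measure M by fact
  note int = bohr_integrable[OF assms(1,2) _ meas]
  have add: "(\<lambda>\<phi>. f \<phi> + g \<phi>) \<in> bohr_continuous"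
    if "f \<in> bohr_continuous" "g \<in> bohr_continuous" for f g :: "(real ^ 'n \<Rightarrow> complex) \<Rightarrow> complex"
    using that by (simp add: bohr_continuous_def continuous_on_add continuous_on_mult_left)
  have scale: "(\<lambda>\<phi>. c * f \<phi>) \<in> bohr_continuous"
    if "f \<in> bohr_continuous" for c and f :: "(real ^ 'n \<Rightarrow> complex) \<Rightarrow> complex"
    using that by (simp add: bohr_continuous_def continuous_on_add continuous_on_mult_left)
  have bound: "cmod (LINT x|M. h (J x)) \<le> measure M (space M) * (SUP \<phi>\<in>bohr. cmod (h \<phi>))"
    if h: "h \<in> bohr_continuous" for h
  proof -
    have "cmod (LINT x|M. h (J x)) \<le> (LINT x|M. cmod (h (J x)))"
      by (rule integral_norm_bound)
    also have "\<dots> \<le> (LINT x|M. (SUP \<phi>\<in>bohr. cmod (h \<phi>)))"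
      using assms(2) h by (intro integral_mono integrable_norm int) (auto intro!: cmod_le_SUP_bohr)
    finally show ?thesis by simp
  qed
  then have "\<exists>B. \<forall>h\<in>bohr_continuous. cmod (LINT x|M. h (J x)) \<le> B * (SUP \<phi>\<in>bohr. cmod (h \<phi>))"
    by blast
  then show ?thesis
    unfolding bohr_dual_def using add scale by (auto simp: int)
qed

lemma measurable_bohr_embed:
  "h \<in> bohr_continuous \<Longrightarrow> (\<lambda>x. h (bohr_embed x)) \<in> borel_measurable borel"
  unfolding bohr_continuous_def
  by (intro borel_measurable_continuous_onI continuous_on_compose2[of bohr h UNIV bohr_embed])
    (auto intro: continuous_on_bohr_embed bohr_embed_in_bohr)

lemma euclidean_functional_in_dual:
  assumes "finite_measure \<mu>" "sets \<mu> = sets borel"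
  shows "euclidean_functional \<mu> \<in> bohr_dual"
  unfolding euclidean_functional_def
  by (intro integral_in_bohr_dual assms)
    (simp_all add: bohr_embed_in_bohr measurable_bohr_embed measurable_cong_sets[OF assms(2) refl])

section \<open>Haar measure and the test on characters\<close>

context
  fixes \<nu> :: "(real ^ 'n \<Rightarrow> complex) measure"
  assumes haar: "bohr_haar_measure \<nu>"
begin

lemma haar_sets: "sets \<nu> = sets (restrict_space borel bohr)"
  using haar by (simp add: bohr_haar_measure_def)

lemma haar_space: "space \<nu> = bohr"
  using sets_eq_imp_space_eq[OF haar_sets] by (simp add: space_restrict_space)

lemma haar_prob: "prob_space \<nu>"
  by (rule prob_spaceI) (use haar in \<open>simp add: bohr_haar_measure_def\<close>)

lemma haar_measurable: "h \<in> bohr_continuous \<Longrightarrow> h \<in> borel_measurable \<nu>"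
  by (simp add: bohr_continuous_def borel_measurable_continuous_on_restrict
      measurable_cong_sets[OF haar_sets refl])

lemma haar_functional_in_dual: "bohr_functional \<nu> \<in> bohr_dual"
  unfolding bohr_functional_def
  using haar_measurable prob_space.finite_measure[OF haar_prob]
  by (intro integral_in_bohr_dual[where J = "\<lambda>\<phi>. \<phi>"]) (auto simp: haar_space)

text \<open>Invariance is given for images of sets, whereas a push-forward is computed from
  preimages. Multiplication by \<open>\<psi>\<close> has multiplication by the conjugate of
  \<open>\<psi>\<close> as its inverse, so a preimage under the former is an image under the
  latter.\<close>

lemma haar_distr_mult:
  assumes "\<psi> \<in> bohr"
  shows "(\<lambda>\<phi> x. \<psi> x * \<phi> x) \<in> measurable \<nu> \<nu>" "distr \<nu> \<nu> (\<lambda>\<phi> x. \<psi> x * \<phi> x) = \<nu>"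
proof -
  have "(\<lambda>\<phi> x. \<psi> x * \<phi> x) \<in> measurable (restrict_space borel bohr) (restrict_space borel bohr)"
  proof (rule measurable_restrict_space2)
    show "(\<lambda>\<phi> x. \<psi> x * \<phi> x) \<in> space (restrict_space borel bohr) \<rightarrow> bohr"
      by (auto simp: space_restrict_space intro!: bohr_mult assms)
    show "(\<lambda>\<phi> x. \<psi> x * \<phi> x) \<in> borel_measurable (restrict_space borel bohr)"
      by (rule borel_measurable_continuous_on_restrict, rule continuous_on_coordinatewise_then_product,
          rule continuous_on_mult_left, rule continuous_on_coordinate)
  qed
  then show m: "(\<lambda>\<phi> x. \<psi> x * \<phi> x) \<in> measurable \<nu> \<nu>"
    by (simp add: measurable_cong_sets[OF haar_sets haar_sets])
  show "distr \<nu> \<nu> (\<lambda>\<phi> x. \<psi> x * \<phi> x) = \<nu>"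
  proof (rule measure_eqI)
    fix A assume "A \<in> sets (distr \<nu> \<nu> (\<lambda>\<phi> x. \<psi> x * \<phi> x))"
    then have A: "A \<in> sets \<nu>" by simp
    then have sub: "A \<subseteq> bohr" using sets.sets_into_space haar_space by blast
    have inv: "\<psi> x * (cnj (\<psi> x) * z) = z" "cnj (\<psi> x) * (\<psi> x * z) = z" for x z
      using bohr_norm[OF assms, of x] complex_norm_square[of "\<psi> x"]
      by (simp_all flip: mult.assoc add: mult.commute[of "cnj _"])
    have "(\<lambda>\<phi> x. \<psi> x * \<phi> x) -` A \<inter> space \<nu> = (\<lambda>\<phi> x. cnj (\<psi> x) * \<phi> x) ` A"
    proof (intro equalityI subsetI)
      fix \<phi> assume "\<phi> \<in> (\<lambda>\<phi> x. \<psi> x * \<phi> x) -` A \<inter> space \<nu>"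
      then show "\<phi> \<in> (\<lambda>\<phi> x. cnj (\<psi> x) * \<phi> x) ` A"
        by (intro image_eqI[of _ _ "\<lambda>x. \<psi> x * \<phi> x"]) (auto simp: inv)
    next
      fix \<phi> assume "\<phi> \<in> (\<lambda>\<phi> x. cnj (\<psi> x) * \<phi> x) ` A"
      then show "\<phi> \<in> (\<lambda>\<phi> x. \<psi> x * \<phi> x) -` A \<inter> space \<nu>"
        using sub by (auto simp: inv haar_space intro!: bohr_mult bohr_cnj assms)
    qed
    then have "emeasure (distr \<nu> \<nu> (\<lambda>\<phi> x. \<psi> x * \<phi> x)) A
        = emeasure \<nu> ((\<lambda>\<phi> x. cnj (\<psi> x) * \<phi> x) ` A)"
      using m A by (simp add: emeasure_distr)
    also have "\<dots> = emeasure \<nu> A"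
      using haar A bohr_cnj[OF assms] by (auto simp: bohr_haar_measure_def)
    finally show "emeasure (distr \<nu> \<nu> (\<lambda>\<phi> x. \<psi> x * \<phi> x)) A = emeasure \<nu> A" .
  qed simp
qed

lemma char_in_bohr_continuous: "(\<lambda>\<phi>. \<phi> \<xi>) \<in> bohr_continuous"
  by (simp add: bohr_continuous_def continuous_on_coordinate)

text \<open>Invariance under multiplication by \<open>\<psi>\<close> multiplies the integral by
  \<open>\<psi> \<xi>\<close>; if this number is not 1, the integral must vanish.\<close>

lemma haar_integral_char:
  "(LINT \<phi>|\<nu>. \<phi> \<xi>) = (if \<xi> = 0 then 1 else 0)"
proof (cases "\<xi> = 0")
  case True
  interpret prob_space \<nu> by (rule haar_prob)
  have "(LINT \<phi>|\<nu>. \<phi> (0 :: real ^ 'n)) = (LINT \<phi>|\<nu>. 1)"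
    by (intro Bochner_Integration.integral_cong refl bohr_zero) (simp add: haar_space)
  with True show ?thesis by (simp add: prob_space)
next
  case False
  \<comment> \<open>The point has inner product \<open>pi\<close> with \<open>\<xi>\<close>, so its
    character takes the value \<open>exp (\<i> * pi) = - 1\<close> at \<open>\<xi>\<close>.\<close>
  define \<psi> where "\<psi> = bohr_embed ((pi / (\<xi> \<bullet> \<xi>)) *\<^sub>R \<xi>)"
  have \<psi>: "\<psi> \<in> bohr" "\<psi> \<xi> = - 1"
    using False by (auto simp: \<psi>_def bohr_embed_in_bohr) (simp add: bohr_embed_def)
  have "(LINT \<phi>|\<nu>. \<phi> \<xi>) = (LINT \<phi>|distr \<nu> \<nu> (\<lambda>\<phi> x. \<psi> x * \<phi> x). \<phi> \<xi>)"
    by (simp add: haar_distr_mult[OF \<psi>(1)])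
  also have "\<dots> = (LINT \<phi>|\<nu>. \<psi> \<xi> * \<phi> \<xi>)"
    using haar_measurable[OF char_in_bohr_continuous]
    by (subst integral_distr[OF haar_distr_mult(1)[OF \<psi>(1)]]) auto
  finally have "(LINT \<phi>|\<nu>. \<phi> \<xi>) = - (LINT \<phi>|\<nu>. \<phi> \<xi>)" using \<psi> by simp
  with False show ?thesis by simp
qed

text \<open>A criterion in the style of Weyl's equidistribution test: the frequencies
  \<open>\<xi> \<noteq> 0\<close> are the hypothesis, frequency 0 is the common mass 1, linearity
  gives trigonometric polynomials, and uniform approximation gives all continuous functions.\<close>

lemma weak_star_limitI:
  fixes \<mu> :: "real \<Rightarrow> (real ^ 'n) measure"
  assumes prob: "\<And>\<epsilon>. \<epsilon> \<in> S \<Longrightarrow> prob_space (\<mu> \<epsilon>)"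
    and sets: "\<And>\<epsilon>. \<epsilon> \<in> S \<Longrightarrow> sets (\<mu> \<epsilon>) = sets borel"
    and conv: "\<And>\<xi>. \<xi> \<noteq> 0 \<Longrightarrow>
      ((\<lambda>\<epsilon>. LINT x|\<mu> \<epsilon>. exp (\<i> * of_real (x \<bullet> \<xi>))) \<longlongrightarrow> 0) (at 0 within S)"
  shows "limitin bohr_weak_star (\<lambda>\<epsilon>. euclidean_functional (\<mu> \<epsilon>)) (bohr_functional \<nu>) (at 0 within S)"
proof -
  interpret N: prob_space \<nu> by (rule haar_prob)
  let ?F = "at (0::real) within S"
  let ?I = "\<lambda>\<epsilon> h. LINT x|\<mu> \<epsilon>. h (bohr_embed x)"
  \<comment> \<open>The measures are controlled only for parameters in \<open>S\<close>; the filter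
    supplies this eventually.\<close>
  have evS: "eventually (\<lambda>\<epsilon>. \<epsilon> \<in> S) ?F"
    by (simp add: eventually_at_filter)
  have intM: "integrable (\<mu> \<epsilon>) (\<lambda>x. h (bohr_embed x))" if "\<epsilon> \<in> S" "h \<in> bohr_continuous" for h \<epsilon>
    by (intro bohr_integrable prob_space.finite_measure prob that)
      (simp_all add: bohr_embed_in_bohr measurable_bohr_embed that
        measurable_cong_sets[OF sets[OF that(1)] refl])
  have intN: "integrable \<nu> h" if "h \<in> bohr_continuous" for h
    using haar_measurable[OF that] that
    by (intro bohr_integrable[where J = "\<lambda>\<phi>. \<phi>"] N.finite_measure_axioms) (auto simp: haar_space)
  have tp: "p \<in> bohr_continuous" if "trig_poly p" for p
    using trig_poly_continuous[OF that] by (simp add: bohr_continuous_def)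
  have trig: "((\<lambda>\<epsilon>. ?I \<epsilon> p) \<longlongrightarrow> (LINT \<phi>|\<nu>. p \<phi>)) ?F" if "trig_poly p" for p
    using that
  proof (induction rule: trig_poly.induct)
    case (char \<xi>)
    show ?case
    proof (cases "\<xi> = 0")
      case True
      have "eventually (\<lambda>\<epsilon>. ?I \<epsilon> (\<lambda>\<phi>. \<phi> \<xi>) = 1) ?F"
        using evS
      proof eventually_elim
        case (elim \<epsilon>)
        interpret prob_space "\<mu> \<epsilon>" using prob[OF elim] .
        show ?case by (simp add: True bohr_embed_def prob_space)
      qed
      then show ?thesis
        by (simp add: haar_integral_char True tendsto_eventually)
    next
      case False
      then show ?thesis using conv[OF False] by (simp add: haar_integral_char bohr_embed_def)
    qed
  next
    case (add p q)
    have "eventually (\<lambda>\<epsilon>. ?I \<epsilon> p + ?I \<epsilon> q = ?I \<epsilon> (\<lambda>\<phi>. p \<phi> + q \<phi>)) ?F"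
      using evS by eventually_elim (simp add: intM tp add)
    from tendsto_cong[OF this] tendsto_add[OF add.IH] show ?case
      by (simp add: Bochner_Integration.integral_add[OF intN intN, OF tp tp, OF add.hyps])
  next
    case (scale p c)
    then show ?case by (auto intro: tendsto_mult)
  qed
  have main: "((\<lambda>\<epsilon>. ?I \<epsilon> h) \<longlongrightarrow> (LINT \<phi>|\<nu>. h \<phi>)) ?F" if h: "h \<in> bohr_continuous" for h
  proof (rule tendstoI)
    fix e :: real assume "e > 0"
    \<comment> \<open>Three errors of at most \<open>e / 4\<close> each: two for exchanging
      \<open>h\<close> and \<open>p\<close> under the two integrals, one for the convergence on
      \<open>p\<close>.\<close>
    obtain p where p: "trig_poly p" "\<And>\<phi>. \<phi> \<in> bohr \<Longrightarrow> cmod (h \<phi> - p \<phi>) \<le> e / 4"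
      using trig_poly_approx[OF h, of "e / 4"] \<open>e > 0\<close> by auto
    note pc = tp[OF p(1)]
    have "eventually (\<lambda>\<epsilon>. dist (?I \<epsilon> p) (LINT \<phi>|\<nu>. p \<phi>) < e / 4) ?F"
      by (rule tendstoD[OF trig[OF p(1)]]) (use \<open>e > 0\<close> in simp)
    with evS show "eventually (\<lambda>\<epsilon>. dist (?I \<epsilon> h) (LINT \<phi>|\<nu>. h \<phi>) < e) ?F"
    proof eventually_elim
      case (elim \<epsilon>)
      interpret M: prob_space "\<mu> \<epsilon>" using prob elim by simp
      have "cmod (?I \<epsilon> h - ?I \<epsilon> p) = cmod (LINT x|\<mu> \<epsilon>. h (bohr_embed x) - p (bohr_embed x))"
        using intM[OF _ h] intM[OF _ pc] elim by simp
      also have "\<dots> \<le> e / 4"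
        using elim
        by (intro M.norm_integral_le Bochner_Integration.integrable_diff intM h pc p bohr_embed_in_bohr)
      finally have 1: "cmod (?I \<epsilon> h - ?I \<epsilon> p) \<le> e / 4" .
      have "cmod ((LINT \<phi>|\<nu>. h \<phi>) - (LINT \<phi>|\<nu>. p \<phi>)) = cmod (LINT \<phi>|\<nu>. h \<phi> - p \<phi>)"
        using intN[OF h] intN[OF pc] by simp
      also have "\<dots> \<le> e / 4"
        by (intro N.norm_integral_le Bochner_Integration.integrable_diff intN h pc p)
          (simp add: haar_space)
      finally have 2: "cmod ((LINT \<phi>|\<nu>. h \<phi>) - (LINT \<phi>|\<nu>. p \<phi>)) \<le> e / 4" .
      have "dist (?I \<epsilon> h) (LINT \<phi>|\<nu>. h \<phi>) \<le> dist (?I \<epsilon> h) (?I \<epsilon> p) +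
          (dist (?I \<epsilon> p) (LINT \<phi>|\<nu>. p \<phi>) + dist (LINT \<phi>|\<nu>. p \<phi>) (LINT \<phi>|\<nu>. h \<phi>))"
        by (intro order_trans[OF dist_triangle[of _ _ "?I \<epsilon> p"]] add_left_mono dist_triangle)
      then show ?case
        using 1 2 elim(2) \<open>e > 0\<close> by (simp add: dist_norm norm_minus_commute)
    qed
  qed
  \<comment> \<open>The weak* topology is a subspace of a product, so there are two obligations:
    convergence at every continuous \<open>h\<close>, and membership in \<open>bohr_dual\<close> of
    the limit and, eventually, of the net.\<close>
  have "limitin (product_topology (\<lambda>_. euclidean) bohr_continuous)
      (\<lambda>\<epsilon>. euclidean_functional (\<mu> \<epsilon>)) (bohr_functional \<nu>) ?F"
    using main unfolding limitin_componentwise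
    by (auto simp: bohr_functional_def euclidean_functional_def)
  moreover have "eventually (\<lambda>\<epsilon>. euclidean_functional (\<mu> \<epsilon>) \<in> bohr_dual) ?F"
    using evS by eventually_elim
      (use prob sets prob_space.finite_measure in \<open>auto intro!: euclidean_functional_in_dual\<close>)
  ultimately show ?thesis
    unfolding bohr_weak_star_def limitin_subtopology using haar_functional_in_dual by blast
qed

end

lemma tendsto_null_sandwich:
  fixes X Y :: "'a \<Rightarrow> real"
  assumes "(Y \<longlongrightarrow> 0) F" "\<And>n. X n \<le> Y n" "\<And>n. 0 \<le> X n"
  shows "(X \<longlongrightarrow> 0) F"
  by (rule tendsto_sandwich[OF _ _ tendsto_const assms(1)]) (simp_all add: assms)

subsection \<open>Lebesgue measure under translations and dilations\<close>

lemma
  fixes f :: "'a::euclidean_space \<Rightarrow> 'b::{banach, second_countable_topology}"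
  assumes [measurable]: "f \<in> borel_measurable borel" and "c \<noteq> 0"
  shows lborel_integrable_affine: "integrable lborel (\<lambda>x. f (t + c *\<^sub>R x)) \<longleftrightarrow> integrable lborel f"
    and lborel_integral_affine:
      "(LINT x|lborel. f x) = \<bar>c\<bar> ^ DIM('a) *\<^sub>R (LINT x|lborel. f (t + c *\<^sub>R x))"
proof -
  note aff = lborel_affine[OF \<open>c \<noteq> 0\<close>, of t]
  have "integrable lborel f \<longleftrightarrow> integrable lborel (\<lambda>x. (\<bar>c\<bar> ^ DIM('a)) *\<^sub>R f (t + c *\<^sub>R x))"
    by (subst aff) (simp add: integrable_density integrable_distr_eq)
  then show "integrable lborel (\<lambda>x. f (t + c *\<^sub>R x)) \<longleftrightarrow> integrable lborel f"
    using integrable_scaleR_right[of "\<bar>c\<bar> ^ DIM('a)" lborel "\<lambda>x. f (t + c *\<^sub>R x)"]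
      integrable_scaleR_right[of "inverse (\<bar>c\<bar> ^ DIM('a))" lborel
        "\<lambda>x. \<bar>c\<bar> ^ DIM('a) *\<^sub>R f (t + c *\<^sub>R x)"] \<open>c \<noteq> 0\<close>
    by auto
  show "(LINT x|lborel. f x) = \<bar>c\<bar> ^ DIM('a) *\<^sub>R (LINT x|lborel. f (t + c *\<^sub>R x))"
    by (subst aff) (simp add: integral_density integral_distr)
qed

lemma
  fixes f :: "'a::euclidean_space \<Rightarrow> 'b::{banach, second_countable_topology}"
  assumes "f \<in> borel_measurable borel"
  shows lborel_integrable_translate: "integrable lborel (\<lambda>x. f (x - w)) \<longleftrightarrow> integrable lborel f"
    and lborel_integral_translate: "(LINT x|lborel. f (x - w)) = (LINT x|lborel. f x)"
  using lborel_integrable_affine[OF assms, of 1 "- w"] lborel_integral_affine[OF assms, of 1 "- w"]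
  by simp_all

lemma nn_integral_lborel_translate:
  fixes f :: "'a::euclidean_space \<Rightarrow> ennreal"
  assumes [measurable]: "f \<in> borel_measurable borel"
  shows "(\<integral>\<^sup>+x. f (x - w) \<partial>lborel) = (\<integral>\<^sup>+x. f x \<partial>lborel)"
  by (subst (2) lborel_distr_plus[of "- w", symmetric]) (simp add: nn_integral_distr)

subsection \<open>Continuity of translations\<close>

definition L1_translation_modulus ::
    "('a::euclidean_space \<Rightarrow> 'b::{banach, second_countable_topology}) \<Rightarrow> 'a \<Rightarrow> real" where
  "L1_translation_modulus f w = (LINT x|lborel. norm (f (x - w) - f x))"

text \<open>Translation is an isometry of \<open>L^1\<close>, so exchanging \<open>f\<close> for
  \<open>g\<close> costs the distance twice, once for the translate and once for the function
  itself.\<close>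

lemma L1_translation_modulus_perturb:
  assumes "integrable lborel f" "integrable lborel g"
  shows "L1_translation_modulus f w
    \<le> L1_translation_modulus g w + 2 * (LINT x|lborel. norm (f x - g x))"
proof -
  have [measurable]: "f \<in> borel_measurable borel" "g \<in> borel_measurable borel"
    using assms by auto
  note [simp] = lborel_integrable_translate assms
  have d: "integrable lborel (\<lambda>x. norm (f (x - w) - g (x - w)))"
    "(LINT x|lborel. norm (f (x - w) - g (x - w))) = (LINT x|lborel. norm (f x - g x))"
    using lborel_integral_translate[of "\<lambda>x. norm (f x - g x)" w] by simp_all
  have "L1_translation_modulus f w \<le> (LINT x|lborel. norm (g (x - w) - g x)
      + (norm (f (x - w) - g (x - w)) + norm (f x - g x)))"
    unfolding L1_translation_modulus_def
  proof (intro integral_mono)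
    fix x
    show "norm (f (x - w) - f x)
      \<le> norm (g (x - w) - g x) + (norm (f (x - w) - g (x - w)) + norm (f x - g x))"
      by norm
  qed (use d in auto)
  also have "\<dots> = L1_translation_modulus g w + 2 * (LINT x|lborel. norm (f x - g x))"
    unfolding L1_translation_modulus_def using d by simp
  finally show ?thesis .
qed

text \<open>The functions whose translates along \<open>w\<close> converge in \<open>L^1\<close>
  form a closed set. This drives the induction over integrable functions below.\<close>

lemma L1_translation_modulus_limit:
  fixes f :: "'a::euclidean_space \<Rightarrow> 'b::{banach, second_countable_topology}"
  assumes "integrable lborel f"
    and g: "\<And>e. e > 0 \<Longrightarrow> \<exists>g. integrable lborel g \<and> (LINT x|lborel. norm (f x - g x)) < e \<and>
      (\<lambda>n. L1_translation_modulus g (w n)) \<longlonglongrightarrow> 0"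
  shows "(\<lambda>n. L1_translation_modulus f (w n)) \<longlonglongrightarrow> 0"
proof (rule LIMSEQ_I)
  fix e :: real assume "e > 0"
  then obtain g where g: "integrable lborel g" "(LINT x|lborel. norm (f x - g x)) < e / 4"
    "(\<lambda>n. L1_translation_modulus g (w n)) \<longlonglongrightarrow> 0"
    using g[of "e / 4"] by auto
  from LIMSEQ_D[OF g(3), of "e / 2"] \<open>e > 0\<close> obtain N
    where N: "\<forall>n\<ge>N. norm (L1_translation_modulus g (w n) - 0) < e / 2" by auto
  have "norm (L1_translation_modulus f (w n) - 0) < e" if "n \<ge> N" for n
  proof -
    have "L1_translation_modulus f (w n) \<ge> 0"
      unfolding L1_translation_modulus_def by (rule integral_nonneg_AE) auto
    with L1_translation_modulus_perturb[OF assms(1) g(1), of "w n"] N that g(2)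
    show ?thesis by fastforce
  qed
  then show "\<exists>N. \<forall>n\<ge>N. norm (L1_translation_modulus f (w n) - 0) < e" by blast
qed

text \<open>Openness gives pointwise convergence on \<open>U\<close>, because \<open>x - w n\<close>
  stays in \<open>U\<close> eventually. Outside \<open>U\<close> the factor
  \<open>indicator U x\<close> makes the product vanish, so boundary points cause no trouble, and
  the same factor is an integrable majorant.\<close>

lemma L1_translation_modulus_open:
  fixes U :: "'a::euclidean_space set" and c :: "'b::{banach, second_countable_topology}"
  assumes "open U" "emeasure lborel U < \<infinity>" "w \<longlonglongrightarrow> 0"
  shows "(\<lambda>n. L1_translation_modulus (\<lambda>x. indicator U x *\<^sub>R c) (w n)) \<longlonglongrightarrow> 0"
proof -
  have [measurable]: "U \<in> sets borel" using assms by auto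
  have int: "integrable lborel (indicator U :: 'a \<Rightarrow> real)"
    using assms by (simp add: integrable_indicator_iff)
  then have intw: "integrable lborel (\<lambda>x. indicator U (x - w n) :: real)" for n
    by (subst lborel_integrable_translate) auto
  have int2: "integrable lborel (\<lambda>x. indicator U x * indicator U (x - w n) :: real)" for n
    by (rule Bochner_Integration.integrable_bound[OF int]) (auto split: split_indicator)
  have lim: "(\<lambda>n. LINT x|lborel. indicator U x * indicator U (x - w n) :: real)
      \<longlonglongrightarrow> (LINT x|lborel. indicator U x)"
  proof (rule integral_dominated_convergence[where w = "indicator U"])
    have "(\<lambda>n. indicator U x * indicator U (x - w n) :: real) \<longlonglongrightarrow> indicator U x" for x
    proof (cases "x \<in> U")
      case True
      have "(\<lambda>n. x - w n) \<longlonglongrightarrow> x" using tendsto_diff[OF tendsto_const assms(3), of x] by simp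
      then have "eventually (\<lambda>n. x - w n \<in> U) sequentially"
        using assms(1) True by (rule topological_tendstoD)
      then have "eventually (\<lambda>n. indicator U x * indicator U (x - w n) = (1::real)) sequentially"
        by eventually_elim (simp add: True)
      then show ?thesis using True by (simp add: tendsto_eventually)
    qed simp
    then show "AE x in lborel. (\<lambda>n. indicator U x * indicator U (x - w n) :: real) \<longlonglongrightarrow> indicator U x"
      by simp
  qed (use int in \<open>auto split: split_indicator\<close>)
  \<comment> \<open>The modulus of an indicator is the measure of a symmetric difference: the two
    measures minus twice that of the intersection.\<close>
  have eq: "L1_translation_modulus (\<lambda>x. indicator U x *\<^sub>R c) (w n) =
    (2 * (LINT x|lborel. indicator U x) - 2 * (LINT x|lborel. indicator U x * indicator U (x - w n))) * norm c" for n
  proof -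
    have "norm (indicator U (x - w n) *\<^sub>R c - indicator U x *\<^sub>R c) =
      (indicator U (x - w n) + indicator U x - 2 * (indicator U x * indicator U (x - w n))) * norm c" for x
      by (auto split: split_indicator)
    then have "L1_translation_modulus (\<lambda>x. indicator U x *\<^sub>R c) (w n) =
      (LINT x|lborel. (indicator U (x - w n) + indicator U x - 2 * (indicator U x * indicator U (x - w n))) * norm c)"
      unfolding L1_translation_modulus_def by simp
    also have "\<dots> = ((LINT x|lborel. indicator U (x - w n)) + (LINT x|lborel. indicator U x)
        - 2 * (LINT x|lborel. indicator U x * indicator U (x - w n))) * norm c"
      using int intw[of n] int2[of n] by simp
    also have "(LINT x|lborel. indicator U (x - w n)) = (LINT x|lborel. indicator U x :: real)"
      by (rule lborel_integral_translate) auto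
    finally show ?thesis by simp
  qed
  have "(\<lambda>n. (2 * (LINT x|lborel. indicator U x) - 2 * (LINT x|lborel. indicator U x * indicator U (x - w n))) * norm c)
      \<longlonglongrightarrow> (2 * (LINT x|lborel. indicator U x) - 2 * (LINT x|lborel. indicator U x)) * norm c"
    by (intro tendsto_intros lim)
  then show ?thesis by (simp add: eq)
qed

text \<open>Induction over integrable functions: indicators are compared with open sets by outer
  regularity, sums use the triangle inequality, and limits use closedness in
  \<open>L^1\<close>.\<close>

lemma L1_translation_continuous:
  fixes f :: "'a::euclidean_space \<Rightarrow> 'b::{banach, second_countable_topology}"
  assumes "integrable lborel f" "w \<longlonglongrightarrow> 0"
  shows "(\<lambda>n. L1_translation_modulus f (w n)) \<longlonglongrightarrow> 0"
  using assms(1)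
proof (induction rule: integrable_induct)
  case (base A c)
  have A: "A \<in> sets borel" using base by simp
  have intA: "integrable lborel (\<lambda>x. indicator A x *\<^sub>R c)"
    using base by (intro integrable_scaleR_left integrable_real_indicator) auto
  show ?case
  proof (rule L1_translation_modulus_limit[OF intA])
    fix e :: real assume "e > 0"
    \<comment> \<open>The summand 1 covers \<open>c = 0\<close> and makes the final estimate
      \<open>\<delta> * norm c < e\<close> strict.\<close>
    define \<delta> where "\<delta> = e / (norm c + 1)"
    have "\<delta> > 0" using \<open>e > 0\<close> by (simp add: \<delta>_def add_nonneg_pos)
    from outer_regular_lborel[OF A this] obtain U
      where U: "open U" "A \<subseteq> U" "emeasure lborel (U - A) < ennreal \<delta>" by auto
    have [measurable]: "U \<in> sets borel" "A \<in> sets borel" using U A by auto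
    have "(U - A) \<inter> A = {}" "(U - A) \<union> A = U" using U(2) by auto
    then have "emeasure lborel U = emeasure lborel (U - A) + emeasure lborel A"
      using plus_emeasure[of "U - A" lborel A] by simp
    also have "\<dots> < \<infinity>" using U(3) base(2) by (auto simp: less_top[symmetric])
    finally have fin: "emeasure lborel U < \<infinity>" .
    have intU: "integrable lborel (\<lambda>x. indicator U x *\<^sub>R c)"
      using fin by (intro integrable_scaleR_left integrable_real_indicator) auto
    have "(LINT x|lborel. norm (indicator A x *\<^sub>R c - indicator U x *\<^sub>R c))
        = (LINT x|lborel. indicator (U - A) x * norm c)"
      using U(2) by (intro Bochner_Integration.integral_cong) (auto split: split_indicator)
    also have "\<dots> = measure lborel (U - A) * norm c"
      by simp
    also have "\<dots> \<le> \<delta> * norm c"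
      using U(3) \<open>\<delta> > 0\<close> by (intro mult_right_mono) (auto simp: measure_def intro: enn2real_leI)
    also have "\<dots> < e"
      using \<open>e > 0\<close> by (simp add: \<delta>_def divide_simps add_nonneg_eq_0_iff add_nonneg_pos)
    finally show "\<exists>g. integrable lborel g \<and> (LINT x|lborel. norm (indicator A x *\<^sub>R c - g x)) < e \<and>
        (\<lambda>n. L1_translation_modulus g (w n)) \<longlonglongrightarrow> 0"
      using intU L1_translation_modulus_open[OF U(1) fin assms(2)] by blast
  qed
next
  case (add f g)
  have [measurable]: "f \<in> borel_measurable borel" "g \<in> borel_measurable borel"
    using add by auto
  have "L1_translation_modulus (\<lambda>x. f x + g x) (w n)
      \<le> L1_translation_modulus f (w n) + L1_translation_modulus g (w n)" for n
  proof -
    have "L1_translation_modulus (\<lambda>x. f x + g x) (w n)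
      \<le> (LINT x|lborel. norm (f (x - w n) - f x) + norm (g (x - w n) - g x))"
      unfolding L1_translation_modulus_def
    proof (intro integral_mono)
      fix x
      show "norm (f (x - w n) + g (x - w n) - (f x + g x))
        \<le> norm (f (x - w n) - f x) + norm (g (x - w n) - g x)" by norm
    qed (simp_all add: add lborel_integrable_translate)
    also have "\<dots> = L1_translation_modulus f (w n) + L1_translation_modulus g (w n)"
      unfolding L1_translation_modulus_def by (simp add: add lborel_integrable_translate)
    finally show ?thesis .
  qed
  note le = this
  have "L1_translation_modulus (\<lambda>x. f x + g x) (w n) \<ge> 0" for n
    unfolding L1_translation_modulus_def by (rule integral_nonneg_AE) auto
  moreover have "(\<lambda>n. L1_translation_modulus f (w n) + L1_translation_modulus g (w n)) \<longlonglongrightarrow> 0"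
    using tendsto_add[OF add.IH] by simp
  ultimately show ?case
    by (intro tendsto_null_sandwich[OF _ le])
next
  case (lim f s)
  have [measurable]: "f \<in> borel_measurable borel" "\<And>i. s i \<in> borel_measurable borel"
    using lim by auto
  \<comment> \<open>The induction rule provides \<open>norm (s i x) \<le> 2 * norm (f x)\<close>,
    whence the majorant \<open>3 * norm (f x)\<close>.\<close>
  have "(\<lambda>i. LINT x|lborel. norm (f x - s i x)) \<longlonglongrightarrow> (LINT x|(lborel :: 'a measure). 0)"
  proof (rule integral_dominated_convergence[where w = "\<lambda>x. 3 * norm (f x)"])
    have "(\<lambda>i. norm (f x - s i x)) \<longlonglongrightarrow> 0" for x
      using tendsto_norm[OF tendsto_diff[OF tendsto_const lim.hyps(2), of x "f x"]] by simp
    then show "AE x in lborel. (\<lambda>i. norm (f x - s i x)) \<longlonglongrightarrow> 0" by simp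
    have "norm (f x - s i x) \<le> 3 * norm (f x)" for x i
      using norm_triangle_ineq4[of "f x" "s i x"] lim.hyps(3)[of x i] by simp
    then show "AE x in lborel. norm (norm (f x - s i x)) \<le> 3 * norm (f x)" for i by simp
  qed (use lim in auto)
  then have *: "(\<lambda>i. LINT x|lborel. norm (f x - s i x)) \<longlonglongrightarrow> 0" by simp
  show ?case
  proof (rule L1_translation_modulus_limit[OF lim.hyps(4)])
    fix e :: real assume "e > 0"
    then have "eventually (\<lambda>i. (LINT x|lborel. norm (f x - s i x)) < e) sequentially"
      using order_tendstoD(2)[OF *] by blast
    then obtain i where "(LINT x|lborel. norm (f x - s i x)) < e"
      by (auto dest: eventually_happens)
    then show "\<exists>g. integrable lborel g \<and> (LINT x|lborel. norm (f x - g x)) < e \<and>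
        (\<lambda>n. L1_translation_modulus g (w n)) \<longlonglongrightarrow> 0"
      using lim by blast
  qed
qed

text \<open>The map \<open>a \<mapsto> |a| a\<close> has an inverse that is Hoelder continuous of exponent 1/2,
  so \<open>L\<^sup>2\<close> continuity follows from \<open>L\<^sup>1\<close> continuity.\<close>

lemma norm_diff_square_le:
  fixes a b :: "'a::real_inner"
  shows "(norm (a - b))\<^sup>2 \<le> 2 * norm (norm a *\<^sub>R a - norm b *\<^sub>R b)"
proof (cases "a = b")
  case False
  define u where "u = norm a *\<^sub>R a - norm b *\<^sub>R b"
  have "(norm a)\<^sup>2 - norm a * norm b + (norm b)\<^sup>2 - a \<bullet> b - (norm (a - b))\<^sup>2 / 2
      = (norm a - norm b)\<^sup>2 / 2"
    by (simp add: power2_norm_eq_inner[of "a - b"] inner_diff inner_commute power2_diff)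
      (simp add: power2_norm_eq_inner field_simps)
  then have 1: "(norm (a - b))\<^sup>2 / 2 \<le> (norm a)\<^sup>2 - norm a * norm b + (norm b)\<^sup>2 - a \<bullet> b"
    by (smt (verit) zero_le_power2 divide_nonneg_nonneg)
  \<comment> \<open>The inner product of \<open>u\<close> with \<open>a - b\<close> factors as
    \<open>norm a + norm b\<close> times the quantity just bounded below. Cauchy-Schwarz bounds it
    above by \<open>norm u * norm (a - b)\<close>, and one factor \<open>norm (a - b)\<close>,
    nonzero in this case, cancels.\<close>
  have "norm (a - b) * ((norm (a - b))\<^sup>2 / 2) \<le> (norm a + norm b) * ((norm (a - b))\<^sup>2 / 2)"
    by (intro mult_right_mono norm_triangle_ineq4) auto
  also have "\<dots> \<le> (norm a + norm b) * ((norm a)\<^sup>2 - norm a * norm b + (norm b)\<^sup>2 - a \<bullet> b)"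
    by (intro mult_left_mono 1) auto
  also have "\<dots> = norm a * (a \<bullet> a) + norm b * (b \<bullet> b) - (norm a + norm b) * (a \<bullet> b)"
    by (simp add: power2_eq_square algebra_simps flip: power2_norm_eq_inner)
  also have "\<dots> = u \<bullet> (a - b)"
    by (simp add: u_def inner_diff inner_commute algebra_simps)
  also have "\<dots> \<le> norm u * norm (a - b)"
    by (rule norm_cauchy_schwarz)
  finally have "norm (a - b) * ((norm (a - b))\<^sup>2 / 2) \<le> norm (a - b) * norm u"
    by (simp add: mult.commute)
  then show ?thesis
    using False by (simp add: u_def)
qed simp

lemma L2_translation_continuous:
  fixes f :: "'a::euclidean_space \<Rightarrow> 'b::euclidean_space"
  assumes f[measurable]: "f \<in> borel_measurable borel" and int: "integrable lborel (\<lambda>x. (norm (f x))\<^sup>2)"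
    and "w \<longlonglongrightarrow> 0"
  shows "(\<lambda>n. LINT x|lborel. (norm (f (x - w n) - f x))\<^sup>2) \<longlonglongrightarrow> 0"
proof -
  \<comment> \<open>The norm of \<open>F x\<close> is \<open>(norm (f x))^2\<close>, so square
    integrability of \<open>f\<close> is integrability of \<open>F\<close>.\<close>
  define F where "F x = norm (f x) *\<^sub>R f x" for x
  have [measurable]: "F \<in> borel_measurable borel" by (simp add: F_def[abs_def])
  have F: "integrable lborel F"
    by (rule Bochner_Integration.integrable_bound[OF int]) (auto simp: F_def power2_eq_square)
  then have intd: "integrable lborel (\<lambda>x. norm (F (x - w n) - F x))" for n
    by (simp add: lborel_integrable_translate)
  have "(LINT x|lborel. (norm (f (x - w n) - f x))\<^sup>2) \<le> 2 * L1_translation_modulus F (w n)" for n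
  proof -
    have le: "(norm (f (x - w n) - f x))\<^sup>2 \<le> 2 * norm (F (x - w n) - F x)" for x
      unfolding F_def by (rule norm_diff_square_le)
    have "integrable lborel (\<lambda>x. (norm (f (x - w n) - f x))\<^sup>2)"
      by (rule Bochner_Integration.integrable_bound[of _ "\<lambda>x. 2 * norm (F (x - w n) - F x)"])
        (use intd le in auto)
    then have "(LINT x|lborel. (norm (f (x - w n) - f x))\<^sup>2) \<le> (LINT x|lborel. 2 * norm (F (x - w n) - F x))"
      using intd le by (intro integral_mono) auto
    then show ?thesis by (simp add: L1_translation_modulus_def)
  qed
  note le = this
  have "(LINT x|lborel. (norm (f (x - w n) - f x))\<^sup>2) \<ge> 0" for n
    by (rule integral_nonneg_AE) auto
  moreover have "(\<lambda>n. 2 * L1_translation_modulus F (w n)) \<longlonglongrightarrow> 0"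
    using tendsto_mult_right_zero[OF L1_translation_continuous[OF F assms(3)]] by simp
  ultimately show ?thesis
    by (intro tendsto_null_sandwich[OF _ le])
qed

subsection \<open>The Gaussian\<close>

definition gauss :: "'a::euclidean_space \<Rightarrow> real" where
  "gauss x = exp (- (norm x)\<^sup>2 / 2)"

lemma gauss_measurable[measurable]: "gauss \<in> borel_measurable borel"
  unfolding gauss_def[abs_def] by measurable

lemma gauss_nonneg: "gauss x \<ge> 0"
  by (simp add: gauss_def)

text \<open>This is the characteristic function of the standard normal law with the normalising
  factor \<open>1 / sqrt (2 * pi)\<close> taken out of the density.\<close>

lemma gauss_fourier_real:
  "has_bochner_integral lborel (\<lambda>y. exp (\<i> * of_real (s * y)) * of_real (exp (- y\<^sup>2 / 2)))
     (of_real (sqrt (2 * pi) * exp (- s\<^sup>2 / 2)))"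
proof -
  interpret N: prob_space std_normal_distribution
    by (rule prob_space_normal_density) simp
  have int: "integrable std_normal_distribution (\<lambda>y. exp (\<i> * of_real (s * y)))"
    by (rule N.integrable_const_bound[where B = 1]) (auto simp: norm_exp_eq_Re)
  have "integrable lborel (\<lambda>y. std_normal_density y *\<^sub>R exp (\<i> * of_real (s * y)))"
    using int by (subst (asm) integrable_density) auto
  moreover have "(LINT y|lborel. std_normal_density y *\<^sub>R exp (\<i> * of_real (s * y))) = of_real (exp (- s\<^sup>2 / 2))"
    using fun_cong[OF char_std_normal_distribution, of s] unfolding char_def
    by (subst (asm) integral_density) auto
  ultimately have "has_bochner_integral lborel
      (\<lambda>y. of_real (sqrt (2 * pi)) * (std_normal_density y *\<^sub>R exp (\<i> * of_real (s * y))))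
      (of_real (sqrt (2 * pi)) * of_real (exp (- s\<^sup>2 / 2)))"
    by (intro has_bochner_integral_mult_right) (simp add: has_bochner_integral_iff)
  moreover have "of_real (sqrt (2 * pi)) * (std_normal_density y *\<^sub>R exp (\<i> * of_real (s * y)))
      = exp (\<i> * of_real (s * y)) * of_real (exp (- y\<^sup>2 / 2))" for y
  proof -
    have "sqrt (2 * pi) * std_normal_density y = exp (- y\<^sup>2 / 2)"
      by (simp add: std_normal_density_def)
    then have "of_real (exp (- y\<^sup>2 / 2)) = (of_real (sqrt (2 * pi)) * of_real (std_normal_density y) :: complex)"
      by (metis of_real_mult)
    then show ?thesis by (simp add: scaleR_conv_of_real mult_ac)
  qed
  ultimately show ?thesis by simp
qed

text \<open>The integrand is a product over the coordinates and Lebesgue measure is the image of a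
  product measure, so the one-dimensional formula is multiplied over the basis.\<close>

lemma gauss_fourier:
  fixes w :: "'a::euclidean_space"
  shows "has_bochner_integral lborel (\<lambda>x. exp (\<i> * of_real (w \<bullet> x)) * of_real (gauss x))
     (of_real (sqrt (2 * pi) ^ DIM('a) * gauss w))"
proof -
  interpret product_sigma_finite "\<lambda>_::'a. lborel :: real measure" ..
  define e where "e b y = exp (\<i> * of_real ((w \<bullet> b) * y)) * complex_of_real (exp (- y\<^sup>2 / 2))" for b y
  have eq: "exp (\<i> * of_real (w \<bullet> (\<Sum>b\<in>Basis. f b *\<^sub>R b))) * of_real (gauss (\<Sum>b\<in>Basis. f b *\<^sub>R b))
      = (\<Prod>b\<in>Basis. e b (f b))" for f :: "'a \<Rightarrow> real"
  proof -
    have 1: "(norm (\<Sum>b\<in>Basis. f b *\<^sub>R b))\<^sup>2 = (\<Sum>b\<in>Basis. (f b)\<^sup>2)"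
      by (subst power2_norm_eq_inner, subst euclidean_inner) (simp add: power2_eq_square)
    show ?thesis
      by (simp add: e_def gauss_def 1 inner_sum_right sum_distrib_left prod.distrib exp_sum
          sum_divide_distrib sum_negf[symmetric] mult.commute)
  qed
  have e: "integrable lborel (e b)"
    "(LINT y|lborel. e b y) = of_real (sqrt (2 * pi) * exp (- (w \<bullet> b)\<^sup>2 / 2))" for b
    using gauss_fourier_real[of "w \<bullet> b"] unfolding e_def[abs_def] has_bochner_integral_iff by blast+
  have "(norm w)\<^sup>2 = (\<Sum>b\<in>Basis. (w \<bullet> b)\<^sup>2)"
    by (subst power2_norm_eq_inner, subst euclidean_inner) (simp add: power2_eq_square)
  then have gw: "(\<Prod>b\<in>Basis. sqrt (2 * pi) * exp (- (w \<bullet> b)\<^sup>2 / 2)) = sqrt (2 * pi) ^ DIM('a) * gauss w"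
    by (simp add: prod.distrib gauss_def exp_sum[symmetric] sum_divide_distrib[symmetric] sum_negf)
  have "integrable (\<Pi>\<^sub>M b\<in>Basis. lborel) (\<lambda>f. \<Prod>b\<in>Basis. e b (f b))"
    by (rule product_integrable_prod) (auto intro: e)
  moreover have "integral\<^sup>L (\<Pi>\<^sub>M b\<in>Basis. lborel) (\<lambda>f. \<Prod>b\<in>Basis. e b (f b)) = of_real (sqrt (2 * pi) ^ DIM('a) * gauss w)"
    by (subst product_integral_prod) (auto intro: e simp: e(2) gw[symmetric])
  ultimately show ?thesis
    by (subst lborel_eq)
      (simp add: has_bochner_integral_iff integrable_distr_eq integral_distr eq)
qed

lemma gauss_integrable: "integrable lborel (gauss :: 'a::euclidean_space \<Rightarrow> real)"
  and gauss_integral: "(LINT x|lborel. gauss (x::'a::euclidean_space)) = sqrt (2 * pi) ^ DIM('a)"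
proof -
  have "has_bochner_integral lborel (\<lambda>x::'a. complex_of_real (gauss x)) (of_real (sqrt (2 * pi) ^ DIM('a)))"
    using gauss_fourier[of "0::'a"] by (simp add: gauss_def)
  then have *: "integrable lborel (\<lambda>x::'a. complex_of_real (gauss x))"
    "(LINT x|lborel. complex_of_real (gauss (x::'a))) = of_real (sqrt (2 * pi) ^ DIM('a))"
    by (simp_all add: has_bochner_integral_iff)
  show "integrable lborel (gauss :: 'a \<Rightarrow> real)"
    using integrable_Re[OF *(1)] by simp
  show "(LINT x|lborel. gauss (x::'a::euclidean_space)) = sqrt (2 * pi) ^ DIM('a)"
    using *(2) by (simp only: integral_complex_of_real of_real_eq_iff)
qed

lemma gauss_scaled_fourier:
  fixes w :: "'a::euclidean_space"
  assumes "\<sigma> > 0"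
  shows "(LINT x|lborel. exp (\<i> * of_real (w \<bullet> x)) * of_real (gauss (\<sigma> *\<^sub>R x)))
     = of_real ((sqrt (2 * pi) / \<sigma>) ^ DIM('a) * gauss (w /\<^sub>R \<sigma>))"
proof -
  have "(LINT x|lborel. exp (\<i> * of_real (w \<bullet> x)) * of_real (gauss (\<sigma> *\<^sub>R x)))
    = (inverse \<sigma>) ^ DIM('a) *\<^sub>R (LINT x|lborel. exp (\<i> * of_real ((w /\<^sub>R \<sigma>) \<bullet> x)) * of_real (gauss x))"
    using assms
    by (subst lborel_integral_affine[of _ "inverse \<sigma>" 0]) (auto simp: inner_commute)
  also have "\<dots> = (inverse \<sigma>) ^ DIM('a) *\<^sub>R of_real (sqrt (2 * pi) ^ DIM('a) * gauss (w /\<^sub>R \<sigma>))"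
    using gauss_fourier[of "w /\<^sub>R \<sigma>"] by (simp add: has_bochner_integral_iff)
  finally show ?thesis
    by (simp add: scaleR_conv_of_real power_divide divide_inverse power_inverse power_mult_distrib mult_ac)
qed

subsection \<open>Plancherel's theorem\<close>

lemma borel_measurable_cnj[measurable]: "cnj \<in> borel_measurable borel"
  by (intro borel_measurable_continuous_onI continuous_intros)

lemma integrable_pair_mult:
  fixes f :: "'a::euclidean_space \<Rightarrow> 'c::{banach, real_normed_field, second_countable_topology}"
    and g :: "'b::euclidean_space \<Rightarrow> 'c"
  assumes f: "integrable lborel f" and g: "integrable lborel g"
  shows "integrable (lborel \<Otimes>\<^sub>M lborel) (\<lambda>(x, y). f x * g y)"
proof (rule lborel_pair.Fubini_integrable)
  have [measurable]: "f \<in> borel_measurable borel" "g \<in> borel_measurable borel"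
    using f g by auto
  show "(\<lambda>(x, y). f x * g y) \<in> borel_measurable (lborel \<Otimes>\<^sub>M lborel)" by measurable
  show "integrable lborel (\<lambda>x. LINT y|lborel. norm (case (x, y) of (x, y) \<Rightarrow> f x * g y))"
    using f g by (simp add: norm_mult)
  show "AE x in lborel. integrable lborel (\<lambda>y. case (x, y) of (x, y) \<Rightarrow> f x * g y)"
    using g by simp
qed

text \<open>The multiplication formula for a bounded kernel: the transform moves from one factor to
  the other. It is used with exponential kernels of both signs.\<close>

lemma kernel_Fubini:
  fixes f :: "'a::euclidean_space \<Rightarrow> complex" and g :: "'b::euclidean_space \<Rightarrow> complex"
  assumes f: "integrable lborel f" and g: "integrable lborel g"
    and e[measurable]: "case_prod e \<in> borel_measurable (borel \<Otimes>\<^sub>M borel)"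
    and bound: "\<And>x y. cmod (e x y) \<le> 1"
  shows "(LINT y|lborel. (LINT x|lborel. e x y * f x) * g y)
       = (LINT x|lborel. f x * (LINT y|lborel. e x y * g y))"
proof -
  have [measurable]: "f \<in> borel_measurable borel" "g \<in> borel_measurable borel"
    using f g by auto
  have "integrable (lborel \<Otimes>\<^sub>M lborel) (\<lambda>(x, y). e x y * f x * g y)"
  proof (rule Bochner_Integration.integrable_bound[OF integrable_pair_mult[OF f g]])
    show "(\<lambda>(x, y). e x y * f x * g y) \<in> borel_measurable (lborel \<Otimes>\<^sub>M lborel)" by measurable
    have "cmod (e x y * f x * g y) \<le> cmod (f x * g y)" for x y
      using mult_right_mono[OF bound[of x y], of "cmod (f x) * cmod (g y)"]
      by (simp add: norm_mult mult.assoc)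
    then show "AE x in lborel \<Otimes>\<^sub>M lborel. norm (case x of (x, y) \<Rightarrow> e x y * f x * g y)
        \<le> norm (case x of (x, y) \<Rightarrow> f x * g y)" by auto
  qed
  from lborel_pair.Fubini_integral[OF this]
  have "(LINT y|lborel. LINT x|lborel. e x y * f x * g y) = (LINT x|lborel. LINT y|lborel. e x y * f x * g y)" .
  also have "\<dots> = (LINT x|lborel. LINT y|lborel. f x * (e x y * g y))"
    by (simp add: mult_ac)
  finally show ?thesis by simp
qed

lemma square_integrableD:
  assumes "square_integrable g"
  shows square_integrable_measurable: "g \<in> borel_measurable borel"
    and square_integrable_integrable: "integrable lborel (\<lambda>x. (cmod (g x))\<^sup>2)"
  using assms by (auto simp: square_integrable_def)

lemma square_integrable_mult:
  assumes "square_integrable f" "square_integrable g"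
  shows "integrable lborel (\<lambda>x. f x * cnj (g x))"
proof (rule Bochner_Integration.integrable_bound)
  show "integrable lborel (\<lambda>x. (cmod (f x))\<^sup>2 + (cmod (g x))\<^sup>2)"
    using assms by (auto simp: square_integrable_def)
  have "cmod (f x * cnj (g x)) \<le> (cmod (f x))\<^sup>2 + (cmod (g x))\<^sup>2" for x
    using sum_squares_bound[of "cmod (f x)" "cmod (g x)"]
      mult_nonneg_nonneg[OF norm_ge_zero norm_ge_zero, of "f x" "g x"]
    unfolding norm_mult complex_mod_cnj by linarith
  then show "AE x in lborel. norm (f x * cnj (g x)) \<le> norm ((cmod (f x))\<^sup>2 + (cmod (g x))\<^sup>2)"
    by simp
qed (use assms in \<open>auto simp: square_integrable_def\<close>)

lemma square_integrable_translate:
  assumes "square_integrable f"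
  shows "square_integrable (\<lambda>x. f (x - w))"
proof -
  have [measurable]: "f \<in> borel_measurable borel" using assms by (rule square_integrable_measurable)
  show ?thesis
    using square_integrable_integrable[OF assms]
      lborel_integrable_translate[of "\<lambda>x. (cmod (f x))\<^sup>2" w]
    by (simp add: square_integrable_def)
qed

lemma fourier_measurable[measurable]:
  assumes [measurable]: "g \<in> borel_measurable borel"
  shows "fourier g \<in> borel_measurable borel"
  unfolding fourier_def[abs_def] by (rule lborel.borel_measurable_lebesgue_integral) measurable

lemma fourier_bound: "cmod (fourier g \<xi>) \<le> (LINT x|lborel. cmod (g x))"
  unfolding fourier_def
  by (rule order_trans[OF integral_norm_bound]) (simp add: norm_mult norm_exp_eq_Re)

lemma cnj_fourier: "cnj (fourier f \<xi>) = (LINT x|lborel. exp (\<i> * of_real (x \<bullet> \<xi>)) * cnj (f x))"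
  unfolding fourier_def
  by (subst Bochner_Integration.integral_cnj[symmetric], rule Bochner_Integration.integral_cong)
    (simp_all add: exp_cnj)

section \<open>Autocorrelation\<close>

text \<open>For integrable \<open>f\<close> its Fourier transform is \<open>|fourier f|^2\<close>,
  and its value at 0 is the squared \<open>L^2\<close> norm; Plancherel's theorem is inversion at
  this one point.\<close>

definition autocorrelation :: "(real ^ 'n \<Rightarrow> complex) \<Rightarrow> real ^ 'n \<Rightarrow> complex" where
  "autocorrelation f w = (LINT x|lborel. f x * cnj (f (x - w)))"

text \<open>Young's inequality, from expanding \<open>(\<eta> * cmod a - cmod b)^2\<close>.
  Constants are not optimal: a factor \<open>1 / 2\<close> is given away.\<close>

lemma cmod_mult_young:
  assumes "\<eta> > 0"
  shows "cmod (a * b) \<le> \<eta> * (cmod a)\<^sup>2 + (cmod b)\<^sup>2 / \<eta>"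
proof -
  have "0 \<le> (\<eta> * cmod a - cmod b)\<^sup>2 / \<eta>" using assms by simp
  also have "\<dots> = \<eta> * (cmod a)\<^sup>2 + (cmod b)\<^sup>2 / \<eta> - 2 * (cmod a * cmod b)"
    using assms by (simp add: power2_eq_square field_simps)
  finally show ?thesis
    using mult_nonneg_nonneg[OF norm_ge_zero norm_ge_zero, of a b] unfolding norm_mult by linarith
qed

text \<open>The companion of Young's inequality: a fixed quantity with arbitrarily small weight
  plus, for each weight, a null term. Together they do the work of the Cauchy-Schwarz inequality for
  integrals.\<close>

lemma tendsto_null_eta:
  fixes X :: "'a \<Rightarrow> real"
  assumes Z: "\<And>\<eta>. \<eta> > 0 \<Longrightarrow> (Z \<eta> \<longlongrightarrow> 0) F" and X0: "\<And>n. 0 \<le> X n"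
    and le: "\<And>\<eta>. \<eta> > 0 \<Longrightarrow> eventually (\<lambda>n. X n \<le> \<eta> * C + Z \<eta> n) F"
  shows "(X \<longlongrightarrow> 0) F"
proof (rule tendstoI)
  fix e :: real assume "e > 0"
  \<comment> \<open>The sign of \<open>C\<close> is arbitrary and \<open>C\<close> may be 0, hence
    \<open>\<bar>C\<bar> + 1\<close> in the denominator.\<close>
  define \<eta> where "\<eta> = e / (2 * (\<bar>C\<bar> + 1))"
  have "\<eta> > 0" using \<open>e > 0\<close> by (simp add: \<eta>_def add_nonneg_pos)
  have "\<eta> * C \<le> \<eta> * (\<bar>C\<bar> + 1)" using \<open>\<eta> > 0\<close> by (intro mult_left_mono) auto
  also have "\<dots> = e / 2" by (simp add: \<eta>_def field_simps)
  finally have C: "\<eta> * C \<le> e / 2" .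
  have "eventually (\<lambda>n. Z \<eta> n < e / 2) F"
    using Z[OF \<open>\<eta> > 0\<close>] \<open>e > 0\<close> by (intro order_tendstoD(2)) auto
  with le[OF \<open>\<eta> > 0\<close>] show "eventually (\<lambda>n. dist (X n) 0 < e) F"
  proof eventually_elim
    case (elim n)
    with C X0[of n] show ?case
      unfolding dist_real_def by linarith
  qed
qed

text \<open>The difference is the inner product of \<open>f\<close> with
  \<open>f (x - w n) - f x\<close>, which tends to 0 in \<open>L^2\<close> by continuity of
  translations.\<close>

lemma autocorrelation_continuous:
  assumes f: "square_integrable f" and w: "w \<longlonglongrightarrow> 0"
  shows "(\<lambda>n. autocorrelation f (w n)) \<longlonglongrightarrow> autocorrelation f 0"
proof -
  have [measurable]: "f \<in> borel_measurable borel" using f by (rule square_integrable_measurable)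
  have sq: "integrable lborel (\<lambda>x. (cmod (f x))\<^sup>2)" using f by (rule square_integrable_integrable)
  note tr = square_integrable_translate[OF f]
  define Y where "Y n = (LINT x|lborel. (cmod (f (x - w n) - f x))\<^sup>2)" for n
  have Y: "Y \<longlonglongrightarrow> 0"
    unfolding Y_def using L2_translation_continuous[OF _ sq w] by simp
  have "(\<lambda>n. cmod (autocorrelation f (w n) - autocorrelation f 0)) \<longlonglongrightarrow> 0"
  proof (rule tendsto_null_eta[where C = "LINT x|lborel. (cmod (f x))\<^sup>2" and Z = "\<lambda>\<eta> n. Y n / \<eta>"])
    fix \<eta> :: real assume "\<eta> > 0"
    show "(\<lambda>n. Y n / \<eta>) \<longlonglongrightarrow> 0" by (rule tendsto_divide_zero[OF Y])
    show "eventually (\<lambda>n. cmod (autocorrelation f (w n) - autocorrelation f 0)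
        \<le> \<eta> * (LINT x|lborel. (cmod (f x))\<^sup>2) + Y n / \<eta>) sequentially"
    proof (rule always_eventually, rule allI)
      fix n
      have intd: "integrable lborel (\<lambda>x. (cmod (f (x - w n) - f x))\<^sup>2)"
      proof (rule Bochner_Integration.integrable_bound)
        show "integrable lborel (\<lambda>x. 2 * (cmod (f (x - w n)))\<^sup>2 + 2 * (cmod (f x))\<^sup>2)"
          using square_integrable_integrable[OF tr, of "w n"] sq by simp
        have "(cmod (a - b))\<^sup>2 \<le> 2 * (cmod a)\<^sup>2 + 2 * (cmod b)\<^sup>2" for a b
          using power_mono[OF norm_triangle_ineq4[of a b], of 2] sum_squares_bound[of "cmod a" "cmod b"]
          by (simp add: power2_sum)
        then show "AE x in lborel. norm ((cmod (f (x - w n) - f x))\<^sup>2)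
            \<le> norm (2 * (cmod (f (x - w n)))\<^sup>2 + 2 * (cmod (f x))\<^sup>2)"
          by simp
      qed simp
      have "autocorrelation f (w n) - autocorrelation f 0
          = (LINT x|lborel. f x * cnj (f (x - w n) - f x))"
        unfolding autocorrelation_def
        using square_integrable_mult[OF f tr] square_integrable_mult[OF f f]
        by (simp add: right_diff_distrib)
      also have "cmod \<dots> \<le> (LINT x|lborel. cmod (f x * cnj (f (x - w n) - f x)))"
        by (rule integral_norm_bound)
      also have "\<dots> \<le> (LINT x|lborel. \<eta> * (cmod (f x))\<^sup>2 + (cmod (f (x - w n) - f x))\<^sup>2 / \<eta>)"
      proof (rule integral_mono)
        show "integrable lborel (\<lambda>x. cmod (f x * cnj (f (x - w n) - f x)))"
          using square_integrable_mult[OF f tr, of "w n"] square_integrable_mult[OF f f]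
          by (auto simp: right_diff_distrib)
        show "cmod (f x * cnj (f (x - w n) - f x)) \<le> \<eta> * (cmod (f x))\<^sup>2 + (cmod (f (x - w n) - f x))\<^sup>2 / \<eta>" for x
          using cmod_mult_young[OF \<open>\<eta> > 0\<close>, of "f x" "cnj (f (x - w n) - f x)"]
          unfolding complex_mod_cnj .
      qed (use sq intd in auto)
      also have "\<dots> = \<eta> * (LINT x|lborel. (cmod (f x))\<^sup>2) + Y n / \<eta>"
        unfolding Y_def using sq intd by simp
      finally show "cmod (autocorrelation f (w n) - autocorrelation f 0)
          \<le> \<eta> * (LINT x|lborel. (cmod (f x))\<^sup>2) + Y n / \<eta>" .
    qed
  qed simp
  then show ?thesis
    by (simp add: LIM_zero_iff tendsto_norm_zero_iff)
qed

lemma autocorrelation_0: "autocorrelation f 0 = of_real (LINT x|lborel. (cmod (f x))\<^sup>2)"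
proof -
  have "autocorrelation f 0 = (LINT x|lborel. of_real ((cmod (f x))\<^sup>2))"
    unfolding autocorrelation_def by (simp only: complex_norm_square diff_zero)
  then show ?thesis by (simp only: integral_complex_of_real)
qed

text \<open>The factor 2 stems from Young's inequality with weight 1. Only a bound uniform in
  \<open>w\<close> matters, as a majorant in Fubini's theorem and in dominated convergence.\<close>

lemma integral_cmod_translate_le:
  assumes f: "square_integrable f"
  shows "(LINT x|lborel. cmod (f x * cnj (f (x - w)))) \<le> 2 * (LINT x|lborel. (cmod (f x))\<^sup>2)"
proof -
  have [measurable]: "f \<in> borel_measurable borel" using f by (rule square_integrable_measurable)
  note tr = square_integrable_translate[OF f]
  note sq = square_integrable_integrable[OF f] square_integrable_integrable[OF tr, of w]
  have "(LINT x|lborel. cmod (f x * cnj (f (x - w))))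
      \<le> (LINT x|lborel. (cmod (f x))\<^sup>2 + (cmod (f (x - w)))\<^sup>2)"
  proof (rule integral_mono)
    show "integrable lborel (\<lambda>x. cmod (f x * cnj (f (x - w))))"
      by (intro integrable_norm square_integrable_mult f tr)
    show "cmod (f x * cnj (f (x - w))) \<le> (cmod (f x))\<^sup>2 + (cmod (f (x - w)))\<^sup>2" for x
      using cmod_mult_young[of 1 "f x" "cnj (f (x - w))"] by simp
  qed (use sq in auto)
  also have "\<dots> = 2 * (LINT x|lborel. (cmod (f x))\<^sup>2)"
    using sq lborel_integral_translate[of "\<lambda>x. (cmod (f x))\<^sup>2" w] by simp
  finally show ?thesis .
qed

lemma autocorrelation_le:
  assumes f: "square_integrable f"
  shows "cmod (autocorrelation f w) \<le> 2 * (LINT x|lborel. (cmod (f x))\<^sup>2)"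
  unfolding autocorrelation_def
  by (rule order_trans[OF integral_norm_bound integral_cmod_translate_le[OF f]])

lemma gauss_scaled_integrable:
  assumes "\<sigma> > 0"
  shows "integrable lborel (\<lambda>x::'a::euclidean_space. gauss (\<sigma> *\<^sub>R x))"
  using lborel_integrable_affine[of "gauss :: 'a \<Rightarrow> real" \<sigma> 0] gauss_integrable assms by simp

text \<open>Both factors of \<open>|fourier f|^2\<close> are written as integrals and the
  integration over \<open>\<xi>\<close> is carried out first. The weight makes the exchange
  legitimate, and its transform is again a Gaussian.\<close>

lemma fourier_gauss_square:
  fixes f :: "real ^ 'n \<Rightarrow> complex"
  assumes f: "integrable lborel f" and "\<sigma> > 0"
  shows "(LINT \<xi>|lborel. of_real ((cmod (fourier f \<xi>))\<^sup>2 * gauss (\<sigma> *\<^sub>R \<xi>)))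
    = of_real (sqrt (2 * pi) ^ CARD('n)) *
      (LINT x|lborel. f x * (LINT z|lborel. of_real (gauss z) * cnj (f (x - \<sigma> *\<^sub>R z))))"
proof -
  have [measurable]: "f \<in> borel_measurable borel" using f by auto
  define G where "G \<xi> = complex_of_real (gauss (\<sigma> *\<^sub>R \<xi>))" for \<xi> :: "real ^ 'n"
  have G: "integrable lborel G"
    unfolding G_def[abs_def] using gauss_scaled_integrable[OF assms(2)] by (rule integrable_of_real)
  have [measurable]: "G \<in> borel_measurable borel" using G by auto
  have g: "integrable lborel (\<lambda>\<xi>. cnj (fourier f \<xi>) * G \<xi>)"
  proof (rule Bochner_Integration.integrable_bound)
    show "integrable lborel (\<lambda>\<xi>. (LINT x|lborel. cmod (f x)) *\<^sub>R G \<xi>)" using G by simp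
    have "cmod (cnj (fourier f \<xi>) * G \<xi>) \<le> cmod ((LINT x|lborel. cmod (f x)) *\<^sub>R G \<xi>)" for \<xi>
      using mult_right_mono[OF fourier_bound[of f \<xi>], of "cmod (G \<xi>)"] by (simp add: norm_mult)
    then show "AE \<xi> in lborel. norm (cnj (fourier f \<xi>) * G \<xi>) \<le> norm ((LINT x|lborel. cmod (f x)) *\<^sub>R G \<xi>)"
      by simp
  qed simp
  have inner: "(LINT \<xi>|lborel. exp (- \<i> * of_real (x \<bullet> \<xi>)) * (cnj (fourier f \<xi>) * G \<xi>))
      = of_real (sqrt (2 * pi) ^ CARD('n)) * (LINT z|lborel. of_real (gauss z) * cnj (f (x - \<sigma> *\<^sub>R z)))" for x
  proof -
    have xG: "integrable lborel (\<lambda>\<xi>. exp (- \<i> * of_real (x \<bullet> \<xi>)) * G \<xi>)"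
      by (rule Bochner_Integration.integrable_bound[OF G]) (auto simp: norm_mult norm_exp_eq_Re)
    have "(LINT \<xi>|lborel. exp (- \<i> * of_real (x \<bullet> \<xi>)) * (cnj (fourier f \<xi>) * G \<xi>))
       = (LINT \<xi>|lborel. (LINT y|lborel. exp (\<i> * of_real (y \<bullet> \<xi>)) * cnj (f y)) *
            (exp (- \<i> * of_real (x \<bullet> \<xi>)) * G \<xi>))"
      by (simp add: cnj_fourier mult_ac)
    also have "\<dots> = (LINT y|lborel. cnj (f y) *
        (LINT \<xi>|lborel. exp (\<i> * of_real (y \<bullet> \<xi>)) * (exp (- \<i> * of_real (x \<bullet> \<xi>)) * G \<xi>)))"
      by (rule kernel_Fubini) (use f xG in \<open>auto simp: norm_exp_eq_Re\<close>)
    also have "\<dots> = (LINT y|lborel. cnj (f y) * of_real ((sqrt (2 * pi) / \<sigma>) ^ CARD('n) * gauss ((y - x) /\<^sub>R \<sigma>)))"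
    proof -
      have "exp (\<i> * of_real (y \<bullet> \<xi>)) * (exp (- \<i> * of_real (x \<bullet> \<xi>)) * G \<xi>)
          = exp (\<i> * of_real ((y - x) \<bullet> \<xi>)) * of_real (gauss (\<sigma> *\<^sub>R \<xi>))" for y \<xi>
        unfolding G_def mult.assoc[symmetric] exp_add[symmetric]
        by (simp add: inner_diff_left algebra_simps)
      then show ?thesis
        by (simp only: gauss_scaled_fourier[OF assms(2)]) simp
    qed
    \<comment> \<open>The substitution \<open>y = x - \<sigma> z\<close>. Its Jacobian
      \<open>\<sigma>^n\<close> cancels the factor \<open>\<sigma>^(-n)\<close> of the scaled
      Gaussian transform, and the Gaussian is even.\<close>
    also have "\<dots> = \<bar>- \<sigma>\<bar> ^ DIM(real ^ 'n) *\<^sub>R (LINT z|lborel. cnj (f (x + (- \<sigma>) *\<^sub>R z)) *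
        of_real ((sqrt (2 * pi) / \<sigma>) ^ CARD('n) * gauss ((x + (- \<sigma>) *\<^sub>R z - x) /\<^sub>R \<sigma>)))"
      using assms(2) by (intro lborel_integral_affine) auto
    also have "\<dots> = \<sigma> ^ CARD('n) *\<^sub>R (LINT z|lborel. of_real ((sqrt (2 * pi) / \<sigma>) ^ CARD('n)) *
        (of_real (gauss z) * cnj (f (x - \<sigma> *\<^sub>R z))))"
      using assms(2) by (simp add: gauss_def mult_ac)
    also have "\<dots> = of_real (sqrt (2 * pi) ^ CARD('n)) * (LINT z|lborel. of_real (gauss z) * cnj (f (x - \<sigma> *\<^sub>R z)))"
      using assms(2) by (simp add: scaleR_conv_of_real power_divide)
    finally show ?thesis .
  qed
  have "(LINT \<xi>|lborel. of_real ((cmod (fourier f \<xi>))\<^sup>2 * gauss (\<sigma> *\<^sub>R \<xi>)))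
     = (LINT \<xi>|lborel. (LINT x|lborel. exp (- \<i> * of_real (x \<bullet> \<xi>)) * f x) * (cnj (fourier f \<xi>) * G \<xi>))"
    unfolding fourier_def[symmetric] of_real_mult complex_norm_square G_def by (simp only: mult.assoc)
  also have "\<dots> = (LINT x|lborel. f x * (LINT \<xi>|lborel. exp (- \<i> * of_real (x \<bullet> \<xi>)) * (cnj (fourier f \<xi>) * G \<xi>)))"
    by (rule kernel_Fubini) (use f g in \<open>auto simp: norm_exp_eq_Re\<close>)
  also have "\<dots> = (LINT x|lborel. of_real (sqrt (2 * pi) ^ CARD('n)) *
      (f x * (LINT z|lborel. of_real (gauss z) * cnj (f (x - \<sigma> *\<^sub>R z)))))"
    unfolding inner by (simp only: mult_ac)
  finally show ?thesis by simp
qed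

text \<open>The integrations over \<open>x\<close> and \<open>z\<close> are exchanged. Absolute
  integrability holds because the overlap of \<open>f\<close> with any translate is bounded
  uniformly and \<open>gauss\<close> is integrable.\<close>

lemma fourier_gauss_autocorrelation:
  fixes f :: "real ^ 'n \<Rightarrow> complex"
  assumes f: "square_integrable f"
  shows "(LINT x|lborel. f x * (LINT z|lborel. of_real (gauss z) * cnj (f (x - \<sigma> *\<^sub>R z))))
    = (LINT z|lborel. of_real (gauss z) * autocorrelation f (\<sigma> *\<^sub>R z))"
proof -
  have [measurable]: "f \<in> borel_measurable borel" using f by (rule square_integrable_measurable)
  let ?F = "\<lambda>z x. of_real (gauss z) * (f x * cnj (f (x - \<sigma> *\<^sub>R z)))"
  have "integrable (lborel \<Otimes>\<^sub>M lborel) (case_prod ?F)"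
  proof (rule lborel_pair.Fubini_integrable)
    show "case_prod ?F \<in> borel_measurable (lborel \<Otimes>\<^sub>M lborel)" by measurable
    show "integrable lborel (\<lambda>z. LINT x|lborel. norm (case_prod ?F (z, x)))"
    proof (rule Bochner_Integration.integrable_bound)
      show "integrable lborel (\<lambda>z::real^'n. gauss z * (2 * (LINT x|lborel. (cmod (f x))\<^sup>2)))"
        by (intro integrable_mult_left gauss_integrable)
      show "(\<lambda>z. LINT x|lborel. norm (case_prod ?F (z, x))) \<in> borel_measurable lborel"
        by measurable
      have "norm (LINT x|lborel. norm (case_prod ?F (z, x)))
          \<le> norm (gauss z * (2 * (LINT x|lborel. (cmod (f x))\<^sup>2)))" for z
      proof -
        have "(LINT x|lborel. norm (case_prod ?F (z, x)))
            = gauss z * (LINT x|lborel. cmod (f x * cnj (f (x - \<sigma> *\<^sub>R z))))"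
          by (simp add: norm_mult gauss_nonneg)
        moreover have "\<dots> \<le> gauss z * (2 * (LINT x|lborel. (cmod (f x))\<^sup>2))"
          by (intro mult_left_mono integral_cmod_translate_le f gauss_nonneg)
        moreover have "0 \<le> (LINT x|lborel. norm (case_prod ?F (z, x)))"
          by (rule integral_nonneg_AE) simp
        ultimately show ?thesis by simp
      qed
      then show "AE z in lborel. norm (LINT x|lborel. norm (case_prod ?F (z, x)))
          \<le> norm (gauss z * (2 * (LINT x|lborel. (cmod (f x))\<^sup>2)))" by simp
    qed
    show "AE z in lborel. integrable lborel (\<lambda>x. case_prod ?F (z, x))"
      using square_integrable_mult[OF f square_integrable_translate[OF f]] by simp
  qed
  from lborel_pair.Fubini_integral[OF this]
  have "(LINT x|lborel. LINT z|lborel. ?F z x) = (LINT z|lborel. LINT x|lborel. ?F z x)" .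
  moreover have "(LINT z|lborel. ?F z x)
      = f x * (LINT z|lborel. of_real (gauss z) * cnj (f (x - \<sigma> *\<^sub>R z)))" for x
    by (subst integral_mult_right_zero[symmetric]) (simp add: mult_ac)
  ultimately show ?thesis
    by (simp add: autocorrelation_def)
qed

text \<open>The nonnegative integral is used since integrability of \<open>|fourier f|^2\<close> is
  part of the claim. As \<open>\<sigma> k\<close> decreases to 0, the weighted integrals increase to
  the left-hand side, while their Gaussian averages of the autocorrelation tend to its value at 0
  times the mass of \<open>gauss\<close>.\<close>

theorem plancherel:
  fixes f :: "real ^ 'n \<Rightarrow> complex"
  assumes f: "integrable lborel f" "square_integrable f"
  shows "(\<integral>\<^sup>+\<xi>. ennreal ((cmod (fourier f \<xi>))\<^sup>2) \<partial>lborel)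
    = ennreal ((2 * pi) ^ CARD('n) * (LINT x|lborel. (cmod (f x))\<^sup>2))"
proof -
  have [measurable]: "f \<in> borel_measurable borel" using f(1) by auto
  let ?N = "LINT x|lborel. (cmod (f x))\<^sup>2"
  define \<sigma> where "\<sigma> k = inverse (real (Suc k))" for k
  have \<sigma>: "\<sigma> k > 0" for k by (simp add: \<sigma>_def)
  have \<sigma>0: "\<sigma> \<longlonglongrightarrow> 0" unfolding \<sigma>_def by (rule LIMSEQ_inverse_real_of_nat)
  let ?h = "\<lambda>k \<xi>. (cmod (fourier f \<xi>))\<^sup>2 * gauss (\<sigma> k *\<^sub>R \<xi>)"
  have h0: "0 \<le> ?h k \<xi>" for k \<xi> by (simp add: gauss_nonneg)
  have hint: "integrable lborel (?h k)" for k
  proof (rule Bochner_Integration.integrable_bound)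
    show "integrable lborel (\<lambda>\<xi>::real^'n. (LINT x|lborel. cmod (f x))\<^sup>2 * gauss (\<sigma> k *\<^sub>R \<xi>))"
      by (intro integrable_mult_right gauss_scaled_integrable \<sigma>)
    show "AE \<xi> in lborel. norm (?h k \<xi>) \<le> norm ((LINT x|lborel. cmod (f x))\<^sup>2 * gauss (\<sigma> k *\<^sub>R \<xi>))"
      by (auto simp: gauss_nonneg intro!: mult_right_mono power_mono fourier_bound)
  qed measurable
  have gA: "(\<lambda>k. LINT z|lborel. of_real (gauss z) * autocorrelation f (\<sigma> k *\<^sub>R z))
      \<longlonglongrightarrow> (LINT z|lborel. of_real (gauss (z :: real ^ 'n)) * of_real ?N)"
  proof (rule integral_dominated_convergence[where w = "\<lambda>z. gauss z * (2 * ?N)"])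
    have [measurable]: "autocorrelation f \<in> borel_measurable borel"
      unfolding autocorrelation_def[abs_def]
      by (rule lborel.borel_measurable_lebesgue_integral) measurable
    show "(\<lambda>z. of_real (gauss z) * autocorrelation f (\<sigma> k *\<^sub>R z)) \<in> borel_measurable lborel" for k
      by measurable
    show "integrable lborel (\<lambda>z::real^'n. gauss z * (2 * ?N))"
      by (intro integrable_mult_left gauss_integrable)
    have "(\<lambda>k. autocorrelation f (\<sigma> k *\<^sub>R z)) \<longlonglongrightarrow> of_real ?N" for z
      unfolding autocorrelation_0[symmetric]
      using tendsto_scaleR[OF \<sigma>0 tendsto_const[of z]]
      by (intro autocorrelation_continuous f) simp
    then show "AE z in lborel. (\<lambda>k. of_real (gauss z) * autocorrelation f (\<sigma> k *\<^sub>R z))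
        \<longlonglongrightarrow> of_real (gauss z) * of_real ?N"
      by (intro AE_I2 tendsto_mult tendsto_const)
    show "AE z in lborel. norm (of_real (gauss z) * autocorrelation f (\<sigma> k *\<^sub>R z)) \<le> gauss z * (2 * ?N)" for k
      by (auto simp: norm_mult gauss_nonneg intro!: mult_left_mono autocorrelation_le f)
  qed measurable
  have gN: "(LINT z|lborel. of_real (gauss (z::real^'n)) * of_real ?N :: complex)
      = of_real (sqrt (2 * pi) ^ CARD('n) * ?N)"
    using gauss_integral[where 'a = "real ^ 'n"] by (simp flip: of_real_mult)
  have "complex_of_real (LINT \<xi>|lborel. ?h k \<xi>) = of_real (sqrt (2 * pi) ^ CARD('n)) *
      (LINT z|lborel. of_real (gauss z) * autocorrelation f (\<sigma> k *\<^sub>R z))" for k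
    unfolding integral_complex_of_real[symmetric] fourier_gauss_square[OF f(1) \<sigma>]
      fourier_gauss_autocorrelation[OF f(2)] ..
  then have "(\<lambda>k. complex_of_real (LINT \<xi>|lborel. ?h k \<xi>))
      \<longlonglongrightarrow> of_real (sqrt (2 * pi) ^ CARD('n)) * of_real (sqrt (2 * pi) ^ CARD('n) * ?N)"
    using tendsto_mult[OF tendsto_const gA] unfolding gN by simp
  \<comment> \<open>One factor \<open>sqrt (2 * pi)^n\<close> comes from the transform of the
    Gaussian, the other from its mass.\<close>
  also have "complex_of_real (sqrt (2 * pi) ^ CARD('n)) * of_real (sqrt (2 * pi) ^ CARD('n) * ?N)
      = of_real ((2 * pi) ^ CARD('n) * ?N)"
    by (simp only: of_real_mult[symmetric] mult.assoc[symmetric] power_mult_distrib[symmetric]) simp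
  finally have lim: "(\<lambda>k. LINT \<xi>|lborel. ?h k \<xi>) \<longlonglongrightarrow> (2 * pi) ^ CARD('n) * ?N"
    by (simp only: tendsto_of_real_iff)
  have "(\<lambda>k. \<integral>\<^sup>+\<xi>. ennreal (?h k \<xi>) \<partial>lborel) \<longlonglongrightarrow> (\<integral>\<^sup>+\<xi>. ennreal ((cmod (fourier f \<xi>))\<^sup>2) \<partial>lborel)"
  proof (rule nn_integral_LIMSEQ)
    have "?h k \<xi> \<le> ?h l \<xi>" if "k \<le> l" for k l \<xi>
    proof -
      have "\<sigma> l \<le> \<sigma> k" using that by (simp add: \<sigma>_def le_imp_inverse_le)
      then have "(\<sigma> l * norm \<xi>)\<^sup>2 \<le> (\<sigma> k * norm \<xi>)\<^sup>2"
        using \<sigma>[of l] by (intro power_mono mult_right_mono) auto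
      then have "gauss (\<sigma> k *\<^sub>R \<xi>) \<le> gauss (\<sigma> l *\<^sub>R \<xi>)"
        using \<sigma>[of l] \<sigma>[of k] by (simp add: gauss_def)
      then show ?thesis by (intro mult_left_mono) auto
    qed
    then show "incseq (\<lambda>k \<xi>. ennreal (?h k \<xi>))"
      by (auto simp: incseq_def le_fun_def intro!: ennreal_leI)
    show "(\<lambda>\<xi>. ennreal (?h k \<xi>)) \<in> borel_measurable lborel" for k by measurable
    have "isCont gauss (0::real^'n)" unfolding gauss_def[abs_def] by (intro continuous_intros) auto
    then have "(\<lambda>k. gauss (\<sigma> k *\<^sub>R \<xi>)) \<longlonglongrightarrow> 1" for \<xi> :: "real ^ 'n"
      using isCont_tendsto_compose[of "0::real^'n" gauss "\<lambda>k. \<sigma> k *\<^sub>R \<xi>"]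
        tendsto_scaleR[OF \<sigma>0 tendsto_const[of \<xi>]] by (simp add: gauss_def)
    from tendsto_mult[OF tendsto_const this]
    have "(\<lambda>k. ?h k \<xi>) \<longlonglongrightarrow> (cmod (fourier f \<xi>))\<^sup>2" for \<xi> by simp
    then show "(\<lambda>k. ennreal (?h k \<xi>)) \<longlonglongrightarrow> ennreal ((cmod (fourier f \<xi>))\<^sup>2)" for \<xi>
      by (rule tendsto_ennrealI)
  qed
  moreover have "(\<integral>\<^sup>+\<xi>. ennreal (?h k \<xi>) \<partial>lborel) = ennreal (LINT \<xi>|lborel. ?h k \<xi>)" for k
    using hint h0 by (intro nn_integral_eq_integral) auto
  ultimately have "(\<lambda>k. ennreal (LINT \<xi>|lborel. ?h k \<xi>))
      \<longlonglongrightarrow> (\<integral>\<^sup>+\<xi>. ennreal ((cmod (fourier f \<xi>))\<^sup>2) \<partial>lborel)" by simp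
  then show ?thesis
    using tendsto_ennrealI[OF lim] LIMSEQ_unique by blast
qed

subsection \<open>The Fourier transform on square integrable functions\<close>

lemma cmod_add_mult_square_le: "(cmod (a + c * b))\<^sup>2 \<le> 2 * (cmod a)\<^sup>2 + 2 * (cmod c)\<^sup>2 * (cmod b)\<^sup>2"
proof -
  have "(cmod (a + c * b))\<^sup>2 \<le> (cmod a + cmod (c * b))\<^sup>2"
    by (intro power_mono norm_triangle_ineq) simp
  also have "\<dots> \<le> 2 * (cmod a)\<^sup>2 + 2 * (cmod (c * b))\<^sup>2"
    using sum_squares_bound[of "cmod a" "cmod (c * b)"] by (simp add: power2_sum)
  finally show ?thesis by (simp add: norm_mult power_mult_distrib)
qed

lemma square_integrable_add:
  assumes f: "square_integrable f" and g: "square_integrable g"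
  shows "square_integrable (\<lambda>x. f x + c * g x)"
  unfolding square_integrable_def
proof
  have [measurable]: "f \<in> borel_measurable borel" "g \<in> borel_measurable borel"
    using assms by (auto intro: square_integrable_measurable)
  show "(\<lambda>x. f x + c * g x) \<in> borel_measurable lborel" by measurable
  show "integrable lborel (\<lambda>x. (cmod (f x + c * g x))\<^sup>2)"
  proof (rule Bochner_Integration.integrable_bound)
    show "integrable lborel (\<lambda>x. 2 * (cmod (f x))\<^sup>2 + 2 * (cmod c)\<^sup>2 * (cmod (g x))\<^sup>2)"
      using square_integrable_integrable[OF f] square_integrable_integrable[OF g] by simp
    have "(cmod (f x + c * g x))\<^sup>2 \<le> 2 * (cmod (f x))\<^sup>2 + 2 * (cmod c)\<^sup>2 * (cmod (g x))\<^sup>2" for x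
      using cmod_add_mult_square_le .
    then show "AE x in lborel. norm ((cmod (f x + c * g x))\<^sup>2)
        \<le> norm (2 * (cmod (f x))\<^sup>2 + 2 * (cmod c)\<^sup>2 * (cmod (g x))\<^sup>2)"
      by simp
  qed measurable
qed

lemma nn_integral_square_integrable:
  assumes "square_integrable f"
  shows "(\<integral>\<^sup>+x. ennreal ((cmod (f x))\<^sup>2) \<partial>lborel) = ennreal (LINT x|lborel. (cmod (f x))\<^sup>2)"
  using square_integrable_integrable[OF assms] by (intro nn_integral_eq_integral) auto

lemma fourier_square_integrable:
  fixes f :: "real ^ 'n \<Rightarrow> complex"
  assumes f: "integrable lborel f" "square_integrable f"
  shows "square_integrable (fourier f)"
    and "(LINT \<xi>|lborel. (cmod (fourier f \<xi>))\<^sup>2) = (2 * pi) ^ CARD('n) * (LINT x|lborel. (cmod (f x))\<^sup>2)"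
proof -
  have [measurable]: "f \<in> borel_measurable borel" using f(1) by auto
  have "integrable lborel (\<lambda>\<xi>. (cmod (fourier f \<xi>))\<^sup>2)"
  proof (rule integrableI_nonneg)
    show "(\<integral>\<^sup>+\<xi>. ennreal ((cmod (fourier f \<xi>))\<^sup>2) \<partial>lborel) < \<infinity>"
      unfolding plancherel[OF f] by simp
  qed auto
  then show sq: "square_integrable (fourier f)" by (simp add: square_integrable_def)
  show "(LINT \<xi>|lborel. (cmod (fourier f \<xi>))\<^sup>2) = (2 * pi) ^ CARD('n) * (LINT x|lborel. (cmod (f x))\<^sup>2)"
    using plancherel[OF f] unfolding nn_integral_square_integrable[OF sq]
    by (subst (asm) ennreal_inj) (auto intro!: integral_nonneg_AE)
qed

lemma L2_norm_tendsto:
  assumes s: "\<And>k::nat. square_integrable (s k)" and f: "square_integrable f"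
    and lim: "(\<lambda>k. \<integral>\<^sup>+ x. ennreal ((cmod (s k x - f x))\<^sup>2) \<partial>lborel) \<longlonglongrightarrow> 0"
  shows "(\<lambda>k. LINT x|lborel. (cmod (s k x))\<^sup>2) \<longlonglongrightarrow> (LINT x|lborel. (cmod (f x))\<^sup>2)"
proof -
  define Y where "Y k = (LINT x|lborel. (cmod (s k x - f x))\<^sup>2)" for k
  have d: "square_integrable (\<lambda>x. s k x - f x)" for k
    using square_integrable_add[OF s f, of k "- 1"] by simp
  note int = square_integrable_integrable[OF d] square_integrable_integrable[OF s]
    square_integrable_integrable[OF f]
  have "Y k \<ge> 0" for k unfolding Y_def by (rule integral_nonneg_AE) simp
  with lim have Y: "Y \<longlonglongrightarrow> 0"
    unfolding nn_integral_square_integrable[OF d] Y_def by (simp add: ennreal_tendsto_0_iff)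
  have "(\<lambda>k. \<bar>(LINT x|lborel. (cmod (s k x))\<^sup>2) - (LINT x|lborel. (cmod (f x))\<^sup>2)\<bar>) \<longlonglongrightarrow> 0"
  proof (rule tendsto_null_eta[where C = "2 * (LINT x|lborel. (cmod (f x))\<^sup>2)"
        and Z = "\<lambda>\<eta> k. Y k + 2 * (Y k / \<eta>)"])
    fix \<eta> :: real assume "\<eta> > 0"
    show "(\<lambda>k. Y k + 2 * (Y k / \<eta>)) \<longlonglongrightarrow> 0"
      using tendsto_add[OF Y tendsto_mult_right_zero[OF tendsto_divide_zero[OF Y], of 2 \<eta>]] by simp
    show "eventually (\<lambda>k. \<bar>(LINT x|lborel. (cmod (s k x))\<^sup>2) - (LINT x|lborel. (cmod (f x))\<^sup>2)\<bar>
      \<le> \<eta> * (2 * (LINT x|lborel. (cmod (f x))\<^sup>2)) + (Y k + 2 * (Y k / \<eta>))) sequentially"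
    proof (rule always_eventually, rule allI)
      fix k
      \<comment> \<open>The difference of squares factors, \<open>cmod a\<close> is at most
        \<open>cmod (a - b) + cmod b\<close>, and Young's inequality treats the mixed term.\<close>
      have pt: "\<bar>(cmod a)\<^sup>2 - (cmod b)\<^sup>2\<bar> \<le> (cmod (a - b))\<^sup>2 + 2 * (\<eta> * (cmod b)\<^sup>2 + (cmod (a - b))\<^sup>2 / \<eta>)" for a b
      proof -
        have "\<bar>(cmod a)\<^sup>2 - (cmod b)\<^sup>2\<bar> = \<bar>cmod a - cmod b\<bar> * (cmod a + cmod b)"
          by (simp add: power2_eq_square square_diff_square_factored abs_mult)
        also have "\<dots> \<le> cmod (a - b) * (cmod (a - b) + 2 * cmod b)"
          using norm_triangle_ineq3[of a b] norm_triangle_sub[of a b] by (intro mult_mono) auto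
        also have "\<dots> = (cmod (a - b))\<^sup>2 + 2 * cmod (b * (a - b))"
          unfolding norm_mult by (simp add: power2_eq_square algebra_simps)
        also have "\<dots> \<le> (cmod (a - b))\<^sup>2 + 2 * (\<eta> * (cmod b)\<^sup>2 + (cmod (a - b))\<^sup>2 / \<eta>)"
          by (intro add_left_mono mult_left_mono cmod_mult_young \<open>\<eta> > 0\<close>) simp
        finally show ?thesis .
      qed
      have "\<bar>(LINT x|lborel. (cmod (s k x))\<^sup>2) - (LINT x|lborel. (cmod (f x))\<^sup>2)\<bar>
        = \<bar>LINT x|lborel. (cmod (s k x))\<^sup>2 - (cmod (f x))\<^sup>2\<bar>"
        using int by simp
      also have "\<dots> \<le> (LINT x|lborel. \<bar>(cmod (s k x))\<^sup>2 - (cmod (f x))\<^sup>2\<bar>)"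
        by (rule integral_abs_bound)
      also have "\<dots> \<le> (LINT x|lborel. (cmod (s k x - f x))\<^sup>2 +
          2 * (\<eta> * (cmod (f x))\<^sup>2 + (cmod (s k x - f x))\<^sup>2 / \<eta>))"
        by (rule integral_mono) (use int pt in simp_all)
      also have "\<dots> = \<eta> * (2 * (LINT x|lborel. (cmod (f x))\<^sup>2)) + (Y k + 2 * (Y k / \<eta>))"
        unfolding Y_def using int by simp
      finally show "\<bar>(LINT x|lborel. (cmod (s k x))\<^sup>2) - (LINT x|lborel. (cmod (f x))\<^sup>2)\<bar>
        \<le> \<eta> * (2 * (LINT x|lborel. (cmod (f x))\<^sup>2)) + (Y k + 2 * (Y k / \<eta>))" .
    qed
  qed simp
  then show ?thesis by (simp add: LIM_zero_iff tendsto_rabs_zero_iff)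
qed

lemma L2_fourierE:
  assumes "L2_fourier f F"
  obtains s where "\<And>k::nat. integrable lborel (s k)" "\<And>k. square_integrable (s k)"
    "(\<lambda>k. \<integral>\<^sup>+ x. ennreal ((cmod (s k x - f x))\<^sup>2) \<partial>lborel) \<longlonglongrightarrow> 0"
    "(\<lambda>k. \<integral>\<^sup>+ \<xi>. ennreal ((cmod (fourier (s k) \<xi> - F \<xi>))\<^sup>2) \<partial>lborel) \<longlonglongrightarrow> 0"
  using assms unfolding L2_fourier_def by blast

lemma L2_fourier_square_integrable:
  assumes "L2_fourier f F"
  shows "square_integrable f" "square_integrable F"
  using assms unfolding L2_fourier_def by auto

text \<open>Both sides are continuous in the \<open>L^2\<close> norm, so Plancherel's identity for
  the approximating functions \<open>s k\<close> passes to the limit.\<close>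

lemma L2_fourier_norm:
  fixes f :: "real ^ 'n \<Rightarrow> complex"
  assumes "L2_fourier f F"
  shows "(LINT \<xi>|lborel. (cmod (F \<xi>))\<^sup>2) = (2 * pi) ^ CARD('n) * (LINT x|lborel. (cmod (f x))\<^sup>2)"
proof -
  note sq = L2_fourier_square_integrable[OF assms]
  obtain s where s: "\<And>k::nat. integrable lborel (s k)" "\<And>k. square_integrable (s k)"
    "(\<lambda>k. \<integral>\<^sup>+ x. ennreal ((cmod (s k x - f x))\<^sup>2) \<partial>lborel) \<longlonglongrightarrow> 0"
    "(\<lambda>k. \<integral>\<^sup>+ \<xi>. ennreal ((cmod (fourier (s k) \<xi> - F \<xi>))\<^sup>2) \<partial>lborel) \<longlonglongrightarrow> 0"
    using L2_fourierE[OF assms] by blast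
  note fs = fourier_square_integrable[OF s(1,2)]
  from L2_norm_tendsto[OF fs(1) sq(2) s(4)]
  have "(\<lambda>k. (2 * pi) ^ CARD('n) * (LINT x|lborel. (cmod (s k x))\<^sup>2))
      \<longlonglongrightarrow> (LINT \<xi>|lborel. (cmod (F \<xi>))\<^sup>2)"
    unfolding fs(2) .
  moreover have "(\<lambda>k. (2 * pi) ^ CARD('n) * (LINT x|lborel. (cmod (s k x))\<^sup>2))
      \<longlonglongrightarrow> (2 * pi) ^ CARD('n) * (LINT x|lborel. (cmod (f x))\<^sup>2)"
    by (intro tendsto_mult tendsto_const L2_norm_tendsto s sq)
  ultimately show ?thesis by (rule LIMSEQ_unique)
qed

lemma nn_integral_null_add:
  fixes d e :: "nat \<Rightarrow> real ^ 'n \<Rightarrow> complex"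
  assumes m: "\<And>k. d k \<in> borel_measurable borel" "\<And>k. e k \<in> borel_measurable borel"
    and d: "(\<lambda>k. \<integral>\<^sup>+ x. ennreal ((cmod (d k x))\<^sup>2) \<partial>lborel) \<longlonglongrightarrow> 0"
    and e: "(\<lambda>k. \<integral>\<^sup>+ x. ennreal ((cmod (e k x))\<^sup>2) \<partial>lborel) \<longlonglongrightarrow> 0"
  shows "(\<lambda>k. \<integral>\<^sup>+ x. ennreal ((cmod (d k x + c * e k x))\<^sup>2) \<partial>lborel) \<longlonglongrightarrow> 0"
proof -
  note [measurable] = m
  have "(\<integral>\<^sup>+ x. ennreal ((cmod (d k x + c * e k x))\<^sup>2) \<partial>lborel)
      \<le> 2 * (\<integral>\<^sup>+ x. ennreal ((cmod (d k x))\<^sup>2) \<partial>lborel)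
        + ennreal (2 * (cmod c)\<^sup>2) * (\<integral>\<^sup>+ x. ennreal ((cmod (e k x))\<^sup>2) \<partial>lborel)" for k
  proof -
    have "(\<integral>\<^sup>+ x. ennreal ((cmod (d k x + c * e k x))\<^sup>2) \<partial>lborel)
        \<le> (\<integral>\<^sup>+ x. 2 * ennreal ((cmod (d k x))\<^sup>2) + ennreal (2 * (cmod c)\<^sup>2) * ennreal ((cmod (e k x))\<^sup>2) \<partial>lborel)"
    proof (rule nn_integral_mono)
      fix x
      have "ennreal ((cmod (d k x + c * e k x))\<^sup>2)
          \<le> ennreal (2 * (cmod (d k x))\<^sup>2 + 2 * (cmod c)\<^sup>2 * (cmod (e k x))\<^sup>2)"
        by (rule ennreal_leI[OF cmod_add_mult_square_le])
      also have "\<dots> = 2 * ennreal ((cmod (d k x))\<^sup>2) + ennreal (2 * (cmod c)\<^sup>2) * ennreal ((cmod (e k x))\<^sup>2)"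
        by (simp add: ennreal_plus ennreal_mult)
      finally show "ennreal ((cmod (d k x + c * e k x))\<^sup>2)
          \<le> 2 * ennreal ((cmod (d k x))\<^sup>2) + ennreal (2 * (cmod c)\<^sup>2) * ennreal ((cmod (e k x))\<^sup>2)" .
    qed
    also have "\<dots> = 2 * (\<integral>\<^sup>+ x. ennreal ((cmod (d k x))\<^sup>2) \<partial>lborel)
        + ennreal (2 * (cmod c)\<^sup>2) * (\<integral>\<^sup>+ x. ennreal ((cmod (e k x))\<^sup>2) \<partial>lborel)"
      by (subst nn_integral_add) (auto simp: nn_integral_cmult)
    finally show ?thesis .
  qed
  note le = this
  have "(\<lambda>k. 2 * (\<integral>\<^sup>+ x. ennreal ((cmod (d k x))\<^sup>2) \<partial>lborel)
        + ennreal (2 * (cmod c)\<^sup>2) * (\<integral>\<^sup>+ x. ennreal ((cmod (e k x))\<^sup>2) \<partial>lborel)) \<longlonglongrightarrow>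
      2 * 0 + ennreal (2 * (cmod c)\<^sup>2) * 0"
    by (intro tendsto_add ennreal_tendsto_cmult d e) auto
  then have lim: "(\<lambda>k. 2 * (\<integral>\<^sup>+ x. ennreal ((cmod (d k x))\<^sup>2) \<partial>lborel)
        + ennreal (2 * (cmod c)\<^sup>2) * (\<integral>\<^sup>+ x. ennreal ((cmod (e k x))\<^sup>2) \<partial>lborel)) \<longlonglongrightarrow> 0"
    by simp
  show ?thesis
    by (rule tendsto_sandwich[OF _ _ tendsto_const lim]) (simp_all add: le)
qed

lemma fourier_integrable: "integrable lborel f \<Longrightarrow> integrable lborel (\<lambda>x. exp (- \<i> * of_real (x \<bullet> \<xi>)) * f x)"
  by (rule Bochner_Integration.integrable_bound[of _ f]) (auto simp: norm_mult norm_exp_eq_Re)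

text \<open>The scalar \<open>c\<close> is built in so that one rule yields all four combinations
  needed for polarization.\<close>

lemma L2_fourier_add:
  assumes f: "L2_fourier f F" and g: "L2_fourier g G"
  shows "L2_fourier (\<lambda>x. f x + c * g x) (\<lambda>\<xi>. F \<xi> + c * G \<xi>)"
proof -
  note sqf = L2_fourier_square_integrable[OF f] and sqg = L2_fourier_square_integrable[OF g]
  have [measurable]: "f \<in> borel_measurable borel" "F \<in> borel_measurable borel"
    "g \<in> borel_measurable borel" "G \<in> borel_measurable borel"
    using sqf sqg by (auto intro: square_integrable_measurable)
  obtain s where s: "\<And>k::nat. integrable lborel (s k)" "\<And>k. square_integrable (s k)"
    "(\<lambda>k. \<integral>\<^sup>+ x. ennreal ((cmod (s k x - f x))\<^sup>2) \<partial>lborel) \<longlonglongrightarrow> 0"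
    "(\<lambda>k. \<integral>\<^sup>+ \<xi>. ennreal ((cmod (fourier (s k) \<xi> - F \<xi>))\<^sup>2) \<partial>lborel) \<longlonglongrightarrow> 0"
    using L2_fourierE[OF f] by blast
  obtain r where r: "\<And>k::nat. integrable lborel (r k)" "\<And>k. square_integrable (r k)"
    "(\<lambda>k. \<integral>\<^sup>+ x. ennreal ((cmod (r k x - g x))\<^sup>2) \<partial>lborel) \<longlonglongrightarrow> 0"
    "(\<lambda>k. \<integral>\<^sup>+ \<xi>. ennreal ((cmod (fourier (r k) \<xi> - G \<xi>))\<^sup>2) \<partial>lborel) \<longlonglongrightarrow> 0"
    using L2_fourierE[OF g] by blast
  have [measurable]: "s k \<in> borel_measurable borel" "r k \<in> borel_measurable borel" for k
    using s(2) r(2) by (auto intro: square_integrable_measurable)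
  have fsr: "fourier (\<lambda>x. s k x + c * r k x) \<xi> = fourier (s k) \<xi> + c * fourier (r k) \<xi>" for k \<xi>
    unfolding fourier_def
    using fourier_integrable[OF s(1), of \<xi> k] fourier_integrable[OF r(1), of \<xi> k]
    by (subst integral_mult_right_zero[symmetric], subst Bochner_Integration.integral_add[symmetric])
      (auto simp: algebra_simps)
  show ?thesis
    unfolding L2_fourier_def
  proof (intro conjI exI[of _ "\<lambda>k x. s k x + c * r k x"] allI)
    show "(\<lambda>k. \<integral>\<^sup>+ x. ennreal ((cmod (s k x + c * r k x - (f x + c * g x)))\<^sup>2) \<partial>lborel) \<longlonglongrightarrow> 0"
      using nn_integral_null_add[OF _ _ s(3) r(3), of c] by (simp add: algebra_simps)
    show "(\<lambda>k. \<integral>\<^sup>+ \<xi>. ennreal ((cmod (fourier (\<lambda>x. s k x + c * r k x) \<xi> - (F \<xi> + c * G \<xi>)))\<^sup>2) \<partial>lborel) \<longlonglongrightarrow> 0"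
      using nn_integral_null_add[OF _ _ s(4) r(4), of c] by (simp add: fsr algebra_simps)
  qed (use s r sqf sqg in \<open>auto intro: square_integrable_add\<close>)
qed

text \<open>The redundant factors \<open>1\<close> and \<open>- 1\<close> give every term the form
  \<open>a + c * b\<close> of \<open>L2_fourier_add\<close>.\<close>

lemma polarization:
  "4 * (a * cnj b) = of_real ((cmod (a + 1 * b))\<^sup>2) - of_real ((cmod (a + (- 1) * b))\<^sup>2)
     + \<i> * of_real ((cmod (a + \<i> * b))\<^sup>2) - \<i> * of_real ((cmod (a + (- \<i>) * b))\<^sup>2)"
  unfolding complex_norm_square by (simp add: algebra_simps)

lemma integral_polarization:
  assumes f: "square_integrable f" and g: "square_integrable g"
  shows "4 * (LINT x|lborel. f x * cnj (g x)) =
    of_real (LINT x|lborel. (cmod (f x + 1 * g x))\<^sup>2) - of_real (LINT x|lborel. (cmod (f x + (- 1) * g x))\<^sup>2)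
     + \<i> * of_real (LINT x|lborel. (cmod (f x + \<i> * g x))\<^sup>2) - \<i> * of_real (LINT x|lborel. (cmod (f x + (- \<i>) * g x))\<^sup>2)"
proof -
  have int: "integrable lborel (\<lambda>x. complex_of_real ((cmod (f x + c * g x))\<^sup>2))" for c
    using square_integrable_integrable[OF square_integrable_add[OF f g]] by (rule integrable_of_real)
  have "4 * (LINT x|lborel. f x * cnj (g x)) = (LINT x|lborel. 4 * (f x * cnj (g x)))"
    by simp
  also have "\<dots> = (LINT x|lborel. of_real ((cmod (f x + 1 * g x))\<^sup>2))
     - (LINT x|lborel. of_real ((cmod (f x + (- 1) * g x))\<^sup>2))
     + \<i> * (LINT x|lborel. of_real ((cmod (f x + \<i> * g x))\<^sup>2))
     - \<i> * (LINT x|lborel. of_real ((cmod (f x + (- \<i>) * g x))\<^sup>2))"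
    unfolding polarization
    by (simp only: int integral_mult_right_zero Bochner_Integration.integral_add
        Bochner_Integration.integral_diff integrable_mult_right Bochner_Integration.integrable_add
        Bochner_Integration.integrable_diff simp_thms)
  finally show ?thesis by (simp only: integral_complex_of_real)
qed

text \<open>Parseval's identity: polarization reduces it to equality of norms for the combinations
  \<open>f + c * g\<close>.\<close>

lemma L2_fourier_inner:
  fixes f g :: "real ^ 'n \<Rightarrow> complex"
  assumes f: "L2_fourier f F" and g: "L2_fourier g G"
  shows "(LINT \<xi>|lborel. F \<xi> * cnj (G \<xi>)) = of_real ((2 * pi) ^ CARD('n)) * (LINT x|lborel. f x * cnj (g x))"
proof -
  note sqf = L2_fourier_square_integrable[OF f] and sqg = L2_fourier_square_integrable[OF g]
  have "4 * (LINT \<xi>|lborel. F \<xi> * cnj (G \<xi>)) =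
      of_real ((2 * pi) ^ CARD('n)) * (4 * (LINT x|lborel. f x * cnj (g x)))"
    unfolding integral_polarization[OF sqf(2) sqg(2)] integral_polarization[OF sqf(1) sqg(1)]
      L2_fourier_norm[OF L2_fourier_add[OF f g]] of_real_mult
    by (simp only: algebra_simps)
  then show ?thesis by (simp add: mult_ac)
qed

lemma fourier_modulate:
  "fourier (\<lambda>x. exp (\<i> * of_real (x \<bullet> \<xi>)) * f x) \<eta> = fourier f (\<eta> - \<xi>)"
proof -
  have "exp (- \<i> * of_real (x \<bullet> \<eta>)) * (exp (\<i> * of_real (x \<bullet> \<xi>)) * f x)
      = exp (- \<i> * of_real (x \<bullet> (\<eta> - \<xi>))) * f x" for x
    unfolding mult.assoc[symmetric] exp_add[symmetric] by (simp add: inner_diff_right algebra_simps)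
  then show ?thesis unfolding fourier_def by (simp only:)
qed

lemma fourier_translate:
  assumes [measurable]: "f \<in> borel_measurable borel"
  shows "fourier (\<lambda>x. f (x - w)) \<eta> = exp (- \<i> * of_real (w \<bullet> \<eta>)) * fourier f \<eta>"
proof -
  have "exp (- \<i> * of_real (x \<bullet> \<eta>)) * f (x - w)
      = exp (- \<i> * of_real (w \<bullet> \<eta>)) * (exp (- \<i> * of_real ((x - w) \<bullet> \<eta>)) * f (x - w))" for x
    unfolding mult.assoc[symmetric] exp_add[symmetric] by (simp add: inner_diff_left algebra_simps)
  then have "fourier (\<lambda>x. f (x - w)) \<eta> = exp (- \<i> * of_real (w \<bullet> \<eta>)) *
      (LINT x|lborel. exp (- \<i> * of_real ((x - w) \<bullet> \<eta>)) * f (x - w))"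
    unfolding fourier_def by (simp only: integral_mult_right_zero)
  also have "(LINT x|lborel. exp (- \<i> * of_real ((x - w) \<bullet> \<eta>)) * f (x - w)) = fourier f \<eta>"
    unfolding fourier_def by (rule lborel_integral_translate) measurable
  finally show ?thesis .
qed

lemma cmod_unimodular_diff: "cmod z = 1 \<Longrightarrow> cmod (z * a - z * b) = cmod (a - b)"
  by (simp add: norm_mult flip: right_diff_distrib)

lemma square_integrable_unimodular:
  assumes f: "square_integrable f" and "e \<in> borel_measurable borel" "\<And>x. cmod (e x) = 1"
  shows "square_integrable (\<lambda>x. e x * f x)"
  using assms by (auto simp: square_integrable_def norm_mult)

lemma cmod_exp_i: "cmod (exp (\<i> * of_real r)) = 1" "cmod (exp (- \<i> * of_real r)) = 1"
  by (simp_all add: norm_exp_eq_Re)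

text \<open>The rule for \<open>fourier\<close> survives the limit because a unimodular factor in
  space and a translation in frequency both preserve \<open>L^2\<close> distances. The translation
  rule below exchanges the two roles.\<close>

lemma L2_fourier_modulate:
  assumes f: "L2_fourier f F"
  shows "L2_fourier (\<lambda>x. exp (\<i> * of_real (x \<bullet> \<xi>)) * f x) (\<lambda>\<eta>. F (\<eta> - \<xi>))"
proof -
  note sq = L2_fourier_square_integrable[OF f]
  have [measurable]: "f \<in> borel_measurable borel" "F \<in> borel_measurable borel"
    using sq by (auto intro: square_integrable_measurable)
  obtain s where s: "\<And>k::nat. integrable lborel (s k)" "\<And>k. square_integrable (s k)"
    "(\<lambda>k. \<integral>\<^sup>+ x. ennreal ((cmod (s k x - f x))\<^sup>2) \<partial>lborel) \<longlonglongrightarrow> 0"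
    "(\<lambda>k. \<integral>\<^sup>+ \<xi>. ennreal ((cmod (fourier (s k) \<xi> - F \<xi>))\<^sup>2) \<partial>lborel) \<longlonglongrightarrow> 0"
    using L2_fourierE[OF f] by blast
  have [measurable]: "s k \<in> borel_measurable borel" for k
    using s(2) by (auto intro: square_integrable_measurable)
  have e: "square_integrable (\<lambda>x. exp (\<i> * of_real (x \<bullet> \<xi>)) * h x)" if "square_integrable h" for h
    by (rule square_integrable_unimodular[OF that _ cmod_exp_i(1)]) measurable
  have tr: "(\<integral>\<^sup>+ \<eta>. ennreal ((cmod (fourier (s k) (\<eta> - \<xi>) - F (\<eta> - \<xi>)))\<^sup>2) \<partial>lborel)
      = (\<integral>\<^sup>+ \<eta>. ennreal ((cmod (fourier (s k) \<eta> - F \<eta>))\<^sup>2) \<partial>lborel)" for k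
    by (rule nn_integral_lborel_translate) measurable
  show ?thesis
    unfolding L2_fourier_def fourier_modulate
  proof (intro conjI exI[of _ "\<lambda>k x. exp (\<i> * of_real (x \<bullet> \<xi>)) * s k x"] allI)
    show "integrable lborel (\<lambda>x. exp (\<i> * of_real (x \<bullet> \<xi>)) * s k x)" for k
      by (rule Bochner_Integration.integrable_bound[OF s(1)]) (auto simp: norm_mult cmod_exp_i)
    show "(\<lambda>k. \<integral>\<^sup>+ x. ennreal ((cmod (exp (\<i> * of_real (x \<bullet> \<xi>)) * s k x
        - exp (\<i> * of_real (x \<bullet> \<xi>)) * f x))\<^sup>2) \<partial>lborel) \<longlonglongrightarrow> 0"
      unfolding cmod_unimodular_diff[OF cmod_exp_i(1)] by (rule s)
    show "(\<lambda>k. \<integral>\<^sup>+ \<eta>. ennreal ((cmod (fourier (\<lambda>x. exp (\<i> * of_real (x \<bullet> \<xi>)) * s k x) \<eta> - F (\<eta> - \<xi>)))\<^sup>2) \<partial>lborel) \<longlonglongrightarrow> 0"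
      unfolding fourier_modulate tr by (rule s)
  qed (intro e s sq square_integrable_translate)+
qed

lemma L2_fourier_translate:
  assumes f: "L2_fourier f F"
  shows "L2_fourier (\<lambda>x. f (x - w)) (\<lambda>\<eta>. exp (- \<i> * of_real (w \<bullet> \<eta>)) * F \<eta>)"
proof -
  note sq = L2_fourier_square_integrable[OF f]
  have [measurable]: "f \<in> borel_measurable borel" "F \<in> borel_measurable borel"
    using sq by (auto intro: square_integrable_measurable)
  obtain s where s: "\<And>k::nat. integrable lborel (s k)" "\<And>k. square_integrable (s k)"
    "(\<lambda>k. \<integral>\<^sup>+ x. ennreal ((cmod (s k x - f x))\<^sup>2) \<partial>lborel) \<longlonglongrightarrow> 0"
    "(\<lambda>k. \<integral>\<^sup>+ \<xi>. ennreal ((cmod (fourier (s k) \<xi> - F \<xi>))\<^sup>2) \<partial>lborel) \<longlonglongrightarrow> 0"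
    using L2_fourierE[OF f] by blast
  have [measurable]: "s k \<in> borel_measurable borel" for k
    using s(2) by (auto intro: square_integrable_measurable)
  have tr: "(\<integral>\<^sup>+ x. ennreal ((cmod (s k (x - w) - f (x - w)))\<^sup>2) \<partial>lborel)
      = (\<integral>\<^sup>+ x. ennreal ((cmod (s k x - f x))\<^sup>2) \<partial>lborel)" for k
    by (rule nn_integral_lborel_translate) measurable
  have ft: "fourier (\<lambda>x. s k (x - w)) \<eta> = exp (- \<i> * of_real (w \<bullet> \<eta>)) * fourier (s k) \<eta>" for k \<eta>
    by (rule fourier_translate) measurable
  show ?thesis
    unfolding L2_fourier_def
  proof (intro conjI exI[of _ "\<lambda>k x. s k (x - w)"] allI)
    show "square_integrable (\<lambda>\<eta>. exp (- \<i> * of_real (w \<bullet> \<eta>)) * F \<eta>)"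
      by (rule square_integrable_unimodular[OF sq(2) _ cmod_exp_i(2)]) measurable
    show "integrable lborel (\<lambda>x. s k (x - w))" for k
      by (subst lborel_integrable_translate) (auto intro: s)
    show "(\<lambda>k. \<integral>\<^sup>+ x. ennreal ((cmod (s k (x - w) - f (x - w)))\<^sup>2) \<partial>lborel) \<longlonglongrightarrow> 0"
      unfolding tr by (rule s)
    show "(\<lambda>k. \<integral>\<^sup>+ \<eta>. ennreal ((cmod (fourier (\<lambda>x. s k (x - w)) \<eta> - exp (- \<i> * of_real (w \<bullet> \<eta>)) * F \<eta>))\<^sup>2) \<partial>lborel) \<longlonglongrightarrow> 0"
      unfolding ft cmod_unimodular_diff[OF cmod_exp_i(2)] by (rule s)
  qed (intro s sq square_integrable_translate)+
qed

subsection \<open>Characteristic function of the Schroedinger evolution\<close>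

text \<open>The multiplier has modulus 1, so \<open>u\<close> and \<open>g\<close> have Fourier
  transforms of equal norm.\<close>

lemma schroedinger_mass:
  assumes "schroedinger t g u"
  shows "square_integrable g" "square_integrable u"
    "(LINT x|lborel. (cmod (u x))\<^sup>2) = (LINT x|lborel. (cmod (g x))\<^sup>2)"
proof -
  obtain G where G: "L2_fourier g G" "L2_fourier u (\<lambda>\<xi>. exp (- \<i> * of_real (t * (norm \<xi>)\<^sup>2)) * G \<xi>)"
    using assms by (auto simp: schroedinger_def)
  show "square_integrable g" "square_integrable u"
    using G L2_fourier_square_integrable by blast+
  show "(LINT x|lborel. (cmod (u x))\<^sup>2) = (LINT x|lborel. (cmod (g x))\<^sup>2)"
    using L2_fourier_norm[OF G(1)] L2_fourier_norm[OF G(2)]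
    by (simp add: norm_mult norm_exp_eq_Re)
qed

lemma schroedinger_char:
  fixes g u :: "real ^ 'n \<Rightarrow> complex"
  assumes "schroedinger t g u"
  shows "(LINT x|lborel. exp (\<i> * of_real (x \<bullet> \<xi>)) * of_real ((cmod (u x))\<^sup>2))
    = exp (- \<i> * of_real (t * (norm \<xi>)\<^sup>2)) *
      (LINT x|lborel. exp (\<i> * of_real (x \<bullet> \<xi>)) * g x * cnj (g (x - (2 * t) *\<^sub>R \<xi>)))"
proof -
  obtain G where G: "L2_fourier g G" "L2_fourier u (\<lambda>\<xi>. exp (- \<i> * of_real (t * (norm \<xi>)\<^sup>2)) * G \<xi>)"
    using assms by (auto simp: schroedinger_def)
  let ?w = "(2 * t) *\<^sub>R \<xi>"
  let ?C = "of_real ((2 * pi) ^ CARD('n)) :: complex"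
  let ?m = "\<lambda>\<eta>::real ^ 'n. exp (- \<i> * of_real (t * (norm \<eta>)\<^sup>2))"
  \<comment> \<open>Expanding the square, \<open>- t |\<eta> - \<xi>|^2 + t |\<eta>|^2\<close>
    equals \<open>- t |\<xi>|^2 + 2 t (\<xi> \<bullet> \<eta>)\<close>. The linear part is the
    conjugate of the factor that \<open>L2_fourier_translate\<close> attaches to a shift by
    \<open>?w\<close>.\<close>
  have mult: "?m (\<eta> - \<xi>) * G (\<eta> - \<xi>) * cnj (?m \<eta> * G \<eta>)
      = ?m \<xi> * (G (\<eta> - \<xi>) * cnj (exp (- \<i> * of_real (?w \<bullet> \<eta>)) * G \<eta>))" for \<eta>
  proof -
    have "?m (\<eta> - \<xi>) * cnj (?m \<eta>) = ?m \<xi> * cnj (exp (- \<i> * of_real (?w \<bullet> \<eta>)))"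
      unfolding exp_cnj exp_add[symmetric]
      by (simp add: power2_norm_eq_inner inner_diff inner_commute algebra_simps)
    then show ?thesis by (simp add: mult_ac)
  qed
  \<comment> \<open>The integral is the inner product of the modulated \<open>u\<close> with
    \<open>u\<close>. Parseval's identity is used twice: to pass to frequencies, and to return with
    \<open>g\<close> and its translate.\<close>
  have "?C * (LINT x|lborel. exp (\<i> * of_real (x \<bullet> \<xi>)) * of_real ((cmod (u x))\<^sup>2))
      = ?C * (LINT x|lborel. exp (\<i> * of_real (x \<bullet> \<xi>)) * u x * cnj (u x))"
    unfolding complex_norm_square by (simp only: mult.assoc)
  also have "\<dots> = (LINT \<eta>|lborel. ?m (\<eta> - \<xi>) * G (\<eta> - \<xi>) * cnj (?m \<eta> * G \<eta>))"
    by (rule L2_fourier_inner[OF L2_fourier_modulate[OF G(2)] G(2), symmetric])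
  also have "\<dots> = ?m \<xi> * (LINT \<eta>|lborel. G (\<eta> - \<xi>) * cnj (exp (- \<i> * of_real (?w \<bullet> \<eta>)) * G \<eta>))"
    unfolding mult by simp
  also have "\<dots> = ?m \<xi> * (?C * (LINT x|lborel. exp (\<i> * of_real (x \<bullet> \<xi>)) * g x * cnj (g (x - ?w))))"
    unfolding L2_fourier_inner[OF L2_fourier_modulate[OF G(1)] L2_fourier_translate[OF G(1)]] ..
  finally show ?thesis by (simp add: mult_ac)
qed

lemma schroedinger_char_le:
  fixes g u :: "real ^ 'n \<Rightarrow> complex"
  assumes "schroedinger t g u"
  shows "cmod (LINT x|lborel. exp (\<i> * of_real (x \<bullet> \<xi>)) * of_real ((cmod (u x))\<^sup>2))
    \<le> (LINT x|lborel. cmod (g x) * cmod (g (x - (2 * t) *\<^sub>R \<xi>)))"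
  unfolding schroedinger_char[OF assms] norm_mult cmod_exp_i mult_1_left
  by (rule order_trans[OF integral_norm_bound]) (simp add: norm_mult norm_exp_eq_Re)

section \<open>Overlap with distant translates and conclusion\<close>

text \<open>The points \<open>y\<close> and \<open>y - w\<close> cannot both have norm below
  \<open>norm w / 2\<close>. So one of the two factors always lies in the tail of \<open>r\<close>,
  whose squared mass \<open>T\<close> vanishes as the radius grows.\<close>

lemma overlap_tendsto_0:
  fixes r :: "'a::euclidean_space \<Rightarrow> real"
  assumes r[measurable]: "r \<in> borel_measurable borel" and r0: "\<And>y. 0 \<le> r y"
    and int: "integrable lborel (\<lambda>y. (r y)\<^sup>2)"
    and w: "filterlim (\<lambda>n. norm (w n)) at_top F"
  shows "((\<lambda>n. LINT y|lborel. r y * r (y - w n)) \<longlongrightarrow> 0) F"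
proof -
  define T where "T R = (LINT y|lborel. indicator {y. R \<le> norm y} y * (r y)\<^sup>2)" for R
  have [measurable]: "{y::'a. R \<le> norm y} \<in> sets borel" for R by measurable
  have intT: "integrable lborel (\<lambda>y. indicator {y. R \<le> norm y} y * (r y)\<^sup>2)" for R
    by (rule Bochner_Integration.integrable_bound[OF int]) (auto split: split_indicator)
  have "(T \<longlongrightarrow> (LINT y|(lborel :: 'a measure). 0)) at_top"
    unfolding T_def
  proof (rule integral_dominated_convergence_at_top[where w = "\<lambda>y. (r y)\<^sup>2"])
    have "((\<lambda>R. indicator {y. R \<le> norm y} y * (r y)\<^sup>2) \<longlongrightarrow> 0) at_top" for y
      by (rule tendsto_eventually, rule eventually_mono[OF eventually_gt_at_top[of "norm y"]]) auto
    then show "AE y in lborel. ((\<lambda>R. indicator {y. R \<le> norm y} y * (r y)\<^sup>2) \<longlongrightarrow> 0) at_top"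
      by simp
    show "\<forall>\<^sub>F R in at_top. AE y in lborel. norm (indicator {y. R \<le> norm y} y * (r y)\<^sup>2) \<le> (r y)\<^sup>2"
      by (intro always_eventually allI AE_I2) (auto split: split_indicator)
  qed (use int in measurable)
  then have T0: "(T \<longlongrightarrow> 0) at_top" by simp
  have "filterlim (\<lambda>n. norm (w n) / 2) at_top F"
    using filterlim_tendsto_pos_mult_at_top[OF tendsto_const _ w, of "1 / 2"] by simp
  then have Tw: "((\<lambda>n. T (norm (w n) / 2)) \<longlongrightarrow> 0) F"
    by (rule filterlim_compose[OF T0])
  show ?thesis
  proof (rule tendsto_null_eta[where C = "2 * (LINT y|lborel. (r y)\<^sup>2)"
        and Z = "\<lambda>\<eta> n. 2 * (T (norm (w n) / 2) / \<eta>)"])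
    fix \<eta> :: real assume "\<eta> > 0"
    show "((\<lambda>n. 2 * (T (norm (w n) / 2) / \<eta>)) \<longlongrightarrow> 0) F"
      by (intro tendsto_mult_right_zero tendsto_divide_zero Tw)
    show "eventually (\<lambda>n. (LINT y|lborel. r y * r (y - w n))
        \<le> \<eta> * (2 * (LINT y|lborel. (r y)\<^sup>2)) + 2 * (T (norm (w n) / 2) / \<eta>)) F"
    proof (rule always_eventually, rule allI)
      fix n
      define R where "R = norm (w n) / 2"
      let ?q = "\<lambda>y. indicator {y. R \<le> norm y} y * (r y)\<^sup>2"
      \<comment> \<open>The two brackets belong to the cases that \<open>y\<close> or
        \<open>y - w n\<close> lies in the tail; their sum is a majorant in either case.\<close>
      let ?p = "\<lambda>y. (\<eta> * (r (y - w n))\<^sup>2 + ?q y / \<eta>) + (\<eta> * (r y)\<^sup>2 + ?q (y - w n) / \<eta>)"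
      have q: "integrable lborel (\<lambda>y. ?q (y - w n))" "(LINT y|lborel. ?q (y - w n)) = T R"
        unfolding T_def
        by (subst lborel_integrable_translate[of ?q], measurable, rule intT)
          (rule lborel_integral_translate, measurable)
      have sq: "integrable lborel (\<lambda>y. (r (y - w n))\<^sup>2)"
        "(LINT y|lborel. (r (y - w n))\<^sup>2) = (LINT y|lborel. (r y)\<^sup>2)"
        by (subst lborel_integrable_translate[of "\<lambda>y. (r y)\<^sup>2"], measurable, rule int)
          (rule lborel_integral_translate, measurable)
      have young: "a * b \<le> \<eta> * b\<^sup>2 + a\<^sup>2 / \<eta>" "b * a \<le> \<eta> * b\<^sup>2 + a\<^sup>2 / \<eta>"
        if "0 \<le> a" "0 \<le> b" for a b :: real
        using cmod_mult_young[OF \<open>\<eta> > 0\<close>, of "of_real b" "of_real a"] that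
        by (simp_all add: norm_mult mult.commute)
      have le: "r y * r (y - w n) \<le> ?p y" for y
      proof -
        have "R \<le> norm y \<or> R \<le> norm (y - w n)"
          using norm_triangle_ineq4[of y "y - w n"] unfolding R_def by simp linarith
        then show ?thesis
          using young[OF r0 r0, of y "y - w n"] young[OF r0 r0, of "y - w n" y] \<open>\<eta> > 0\<close>
          by (auto split: split_indicator intro: add_increasing2 add_increasing)
      qed
      have "(LINT y|lborel. r y * r (y - w n)) \<le> (LINT y|lborel. ?p y)"
      \<comment> \<open>Only the nonnegative majorant has to be integrable: the integral of a
        product that failed to be so would be 0 by convention.\<close>
      proof (rule integral_mono_AE')
        show "integrable lborel ?p"
          using q(1) sq(1) int intT by simp
      qed (use le r0 \<open>\<eta> > 0\<close> in auto)
      also have "\<dots> = \<eta> * (2 * (LINT y|lborel. (r y)\<^sup>2)) + 2 * (T R / \<eta>)"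
        using q sq int intT by (simp add: T_def)
      finally show "(LINT y|lborel. r y * r (y - w n))
        \<le> \<eta> * (2 * (LINT y|lborel. (r y)\<^sup>2)) + 2 * (T (norm (w n) / 2) / \<eta>)"
        by (simp add: R_def)
    qed
  qed (auto intro!: integral_nonneg_AE AE_I2 mult_nonneg_nonneg r0)
qed

text \<open>The real \<open>sqrt\<close> is an odd function, so its modulus is the root of the
  absolute value even where \<open>\<rho>\<close> is negative.\<close>

lemma abs_sqrt_rescale:
  fixes \<rho> :: "real ^ 'n \<Rightarrow> real"
  assumes "\<epsilon> > 0"
  shows "cmod (of_real (sqrt (rescale \<epsilon> \<rho> x))) = sqrt \<bar>\<rho> (x /\<^sub>R \<epsilon>)\<bar> / sqrt (\<epsilon> ^ CARD('n))"
  unfolding norm_of_real using assms by (simp add: rescale_def real_sqrt_divide real_sqrt_abs')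

theorem proposition3p10:
  fixes a :: "real ^ 'n" and t :: real and \<rho> :: "real ^ 'n \<Rightarrow> real"
    and u :: "real \<Rightarrow> real ^ 'n \<Rightarrow> complex"
    and \<nu> :: "(real ^ 'n \<Rightarrow> complex) measure"
  assumes "t \<noteq> 0"
    and "integrable lborel \<rho>"
    and "AE x in lborel. \<rho> x \<ge> 0"
    and "integrable lborel (\<lambda>x. sqrt (\<rho> x))"
    and "(LINT x|lborel. \<rho> x) = 1"
    and "\<And>\<epsilon>. \<epsilon> \<in> {0<..1} \<Longrightarrow>
           schroedinger t (\<lambda>x. of_real (sqrt (rescale \<epsilon> \<rho> (x - a)))) (u \<epsilon>)"
    and "bohr_haar_measure \<nu>"
  shows "limitin bohr_weak_star
           (\<lambda>\<epsilon>. euclidean_functional (square_density_measure (u \<epsilon>)))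
           (bohr_functional \<nu>) (at 0 within {0<..1})"
proof (rule weak_star_limitI[OF assms(7)])
  have [measurable]: "\<rho> \<in> borel_measurable borel" using assms(2) by auto
  \<comment> \<open>As \<open>\<rho>\<close> is nonnegative only almost everywhere, the absolute
    value provides a version of the root that is nonnegative at every point.\<close>
  define r where "r y = sqrt \<bar>\<rho> y\<bar>" for y
  define g where "g \<epsilon> x = complex_of_real (sqrt (rescale \<epsilon> \<rho> (x - a)))" for \<epsilon> x
  have [measurable]: "r \<in> borel_measurable borel" unfolding r_def[abs_def] by measurable
  have r2: "(r y)\<^sup>2 = \<bar>\<rho> y\<bar>" for y by (simp add: r_def)
  have intr: "integrable lborel (\<lambda>y. (r y)\<^sup>2)" unfolding r2 using assms(2) by simp
  have gr: "cmod (g \<epsilon> (a + \<epsilon> *\<^sub>R y)) = r y / sqrt (\<epsilon> ^ CARD('n))" if "\<epsilon> > 0" for \<epsilon> y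
    using abs_sqrt_rescale[OF that, of \<rho> "\<epsilon> *\<^sub>R y"] that by (simp add: g_def r_def)
  have [measurable]: "g \<epsilon> \<in> borel_measurable borel" for \<epsilon>
    unfolding g_def[abs_def] rescale_def by measurable
  have sch: "schroedinger t (g \<epsilon>) (u \<epsilon>)" if "\<epsilon> \<in> {0<..1}" for \<epsilon>
    using assms(6)[OF that] by (simp add: g_def[abs_def])
  \<comment> \<open>The substitution \<open>x = a + \<epsilon> y\<close> removes the centre
    \<open>a\<close>. The Jacobian \<open>\<epsilon>^n\<close> cancels the two factors
    \<open>\<epsilon>^(-n/2)\<close>, so the scale survives only in the displacement
    \<open>w / \<epsilon>\<close>.\<close>
  have overlap: "(LINT x|lborel. cmod (g \<epsilon> x) * cmod (g \<epsilon> (x - w))) = (LINT y|lborel. r y * r (y - w /\<^sub>R \<epsilon>))"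
    if "\<epsilon> > 0" for \<epsilon> w
  proof -
    have shift: "a + \<epsilon> *\<^sub>R y - w = a + \<epsilon> *\<^sub>R (y - w /\<^sub>R \<epsilon>)" for y
      using that by (simp add: scaleR_diff_right)
    have "(LINT x|lborel. cmod (g \<epsilon> x) * cmod (g \<epsilon> (x - w)))
        = \<epsilon> ^ CARD('n) * (LINT y|lborel. cmod (g \<epsilon> (a + \<epsilon> *\<^sub>R y)) * cmod (g \<epsilon> (a + \<epsilon> *\<^sub>R y - w)))"
      using that by (subst lborel_integral_affine[of _ \<epsilon> a]) auto
    also have "\<dots> = \<epsilon> ^ CARD('n) * (LINT y|lborel. (r y * r (y - w /\<^sub>R \<epsilon>)) / \<epsilon> ^ CARD('n))"
      unfolding shift gr[OF that] using that by simp
    finally show ?thesis using that by simp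
  qed
  \<comment> \<open>Conservation of mass reduces this to the initial value, whose mass is the
    overlap at displacement 0.\<close>
  have mass: "(LINT x|lborel. (cmod (u \<epsilon> x))\<^sup>2) = 1" if "\<epsilon> \<in> {0<..1}" for \<epsilon>
  proof -
    have "(LINT x|lborel. (cmod (u \<epsilon> x))\<^sup>2) = (LINT x|lborel. cmod (g \<epsilon> x) * cmod (g \<epsilon> (x - 0)))"
      unfolding schroedinger_mass(3)[OF sch[OF that]] by (simp add: power2_eq_square)
    also have "\<dots> = (LINT y|lborel. \<rho> y)"
    proof (subst overlap)
      show "(LINT y|lborel. r y * r (y - 0 /\<^sub>R \<epsilon>)) = (LINT y|lborel. \<rho> y)"
        using assms(3) by (intro integral_cong_AE) (auto simp: r2 simp flip: power2_eq_square)
    qed (use that in auto)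
    finally show ?thesis using assms(5) by simp
  qed
  have mu[measurable]: "u \<epsilon> \<in> borel_measurable borel" if "\<epsilon> \<in> {0<..1}" for \<epsilon>
    using schroedinger_mass(2)[OF sch[OF that]] by (rule square_integrable_measurable)
  show "sets (square_density_measure (u \<epsilon>)) = sets borel" for \<epsilon>
    by (simp add: square_density_measure_def)
  show "prob_space (square_density_measure (u \<epsilon>))" if "\<epsilon> \<in> {0<..1}" for \<epsilon>
  proof (rule prob_spaceI)
    note [measurable] = mu[OF that]
    show "emeasure (square_density_measure (u \<epsilon>)) (space (square_density_measure (u \<epsilon>))) = 1"
      using nn_integral_square_integrable[OF schroedinger_mass(2)[OF sch[OF that]]] mass[OF that]
      by (simp add: square_density_measure_def emeasure_density)
  qed
  fix \<xi> :: "real ^ 'n" assume "\<xi> \<noteq> 0"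
  let ?F = "at (0::real) within {0<..1}"
  let ?w = "(2 * t) *\<^sub>R \<xi>"
  \<comment> \<open>Here \<open>t \<noteq> 0\<close> and \<open>\<xi> \<noteq> 0\<close> enter: the
    displacement \<open>?w\<close> is nonzero, so its length divided by \<open>\<epsilon>\<close>
    diverges.\<close>
  have "filterlim (\<lambda>\<epsilon>. norm ?w * inverse \<epsilon>) at_top (at_right (0::real))"
    using \<open>\<xi> \<noteq> 0\<close> assms(1)
    by (intro filterlim_tendsto_pos_mult_at_top[OF tendsto_const _ filterlim_inverse_at_top_right]) auto
  then have fl: "filterlim (\<lambda>\<epsilon>. norm ?w * inverse \<epsilon>) at_top ?F"
    by (rule filterlim_mono[OF _ order_refl at_le]) auto
  have "eventually (\<lambda>\<epsilon>. norm ?w * inverse \<epsilon> = norm (?w /\<^sub>R \<epsilon>)) ?F"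
    unfolding eventually_at_filter by (rule always_eventually) (simp add: abs_mult)
  from iffD1[OF filterlim_cong[OF refl refl this] fl]
  have w: "filterlim (\<lambda>\<epsilon>. norm (?w /\<^sub>R \<epsilon>)) at_top ?F" .
  have lim: "((\<lambda>\<epsilon>. LINT y|lborel. r y * r (y - ?w /\<^sub>R \<epsilon>)) \<longlongrightarrow> 0) ?F"
    by (rule overlap_tendsto_0[OF _ _ intr w]) (measurable, simp add: r_def)
  have "eventually (\<lambda>\<epsilon>. norm (LINT x|square_density_measure (u \<epsilon>). exp (\<i> * of_real (x \<bullet> \<xi>)))
      \<le> (LINT y|lborel. r y * r (y - ?w /\<^sub>R \<epsilon>))) ?F"
  proof -
    have "norm (LINT x|square_density_measure (u \<epsilon>). exp (\<i> * of_real (x \<bullet> \<xi>)))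
      \<le> (LINT y|lborel. r y * r (y - ?w /\<^sub>R \<epsilon>))" if "\<epsilon> \<in> {0<..1}" for \<epsilon>
    proof -
      note [measurable] = mu[OF that]
      have "(LINT x|square_density_measure (u \<epsilon>). exp (\<i> * of_real (x \<bullet> \<xi>)))
          = (LINT x|lborel. exp (\<i> * of_real (x \<bullet> \<xi>)) * of_real ((cmod (u \<epsilon> x))\<^sup>2))"
        unfolding square_density_measure_def
        by (subst integral_density) (auto simp: scaleR_conv_of_real mult.commute)
      then show ?thesis
        using schroedinger_char_le[OF sch[OF that], of \<xi>] overlap[of \<epsilon> ?w] that by simp
    qed
    then show ?thesis by (auto simp: eventually_at_filter)
  qed
  then show "((\<lambda>\<epsilon>. LINT x|square_density_measure (u \<epsilon>). exp (\<i> * of_real (x \<bullet> \<xi>))) \<longlongrightarrow> 0) ?F"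
    using lim by (rule Lim_null_comparison)
qed

end
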